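(* Let $p,s\ge 0$ and $q,r>0$ be such that at least one of the following conditions holds: (1) $r\min\left\{1,\frac{2-q}{1+p}\right\}\ge 2$; (2) $q\min\left\{1,\frac{2-r}{1+s}\right\}\ge 2$; (3) $p>\max\{1,r-1\}$, $2r>(1-s)(1+p)$, and $q(1+p-r)>(1+p)(1+s)$; (4) $s>\max\{1,q-1\}$, $2q>(1-p)(1+s)$, and $r(1+s-q)>(1+p)(1+s)$. Then the system $$F(D^2u,Du,u,x)=u^{-p}v^{-q}\ \text{in }\Omega,\qquad F(D^2v,Dv,v,x)=u^{-r}v^{-s}\ \text{in }\Omega,\qquad u=v=0\ \text{on }\partial\Omega$$ admits no positive solutions $(u,v)$.
   Context: $\Omega\subset\mathbb{R}^N$ is a bounded domain with $C^2$ boundary, and $S(N)$ is the set of real symmetric $N\times N$ matrices. For $0<\lambda\le\Lambda$, the Pucci operators are $\mathcal{P}^+_{\lambda,\Lambda}(M)=\sup_{A}[-\operatorname{Tr}(AM)]$ and $\mathcal{P}^-_{\lambda,\Lambda}(M)=\inf_{A}[-\operatorname{Tr}(AM)]$, with $A$ ranging over real symmetric matrices whose eigenvalues lie in $[\lambda,\Lambda]$. Write $t^+=\max\{t,0\}$, $t^-=\max\{-t,0\}$. The operator $F:S(N)\times\mathbb{R}^N\times\mathbb{R}\times\Omega\to\mathbb{R}$ satisfies, for some constants $0<\lambda\le\Lambda$, $\Gamma,\gamma\ge0$, $C>0$, $\theta\in(0,1]$ and for all $M,M'\in S(N)$, $\xi,\xi'\in\mathbb{R}^N$, $z,z'\in\mathbb{R}$,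 $x,y\in\Omega$: (i) $F(tM,t\xi,tz,x)=tF(M,\xi,z,x)$ for all $t\ge0$; (ii) $|F(M,\xi,z,x)-F(M,\xi,z,y)|\le C|x-y|^{\theta}(1+|M|+|\xi|+|z|)$; (iii) $F$ is convex in $(M,\xi,z)$; (iv) $\mathcal{P}^-_{\lambda,\Lambda}(M-M')-\Gamma|\xi-\xi'|-\gamma(z'-z)^+\le F(M,\xi,z,x)-F(M',\xi',z',x)\le \mathcal{P}^+_{\lambda,\Lambda}(M-M')+\Gamma|\xi-\xi'|+\gamma(z'-z)^-$. Solutions are viscosity solutions: a pair $(u_1,u_2)\in C(\overline\Omega)\times C(\overline\Omega)$ is a viscosity subsolution (resp. supersolution) of $F(D^2u_i,Du_i,u_i,x)=f_i(u_1,u_2)$ in $\Omega$, $i=1,2$, if for each $i$ and each $\phi\in C^2(\Omega)$ such that $u_i-\phi$ has a local maximum (resp. minimum) at $x_0\in\Omega$, one has $F(D^2\phi(x_0),D\phi(x_0),u_i(x_0),x_0)\le f_i(u_1(x_0),u_2(x_0))$ (resp. $\ge$). A solution is both a sub- and a supersolution and takes the prescribed boundary values. A positive solution satisfies $u,v>0$ in $\Omega$. *)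

theory Defs
  imports "HOL-Analysis.Analysis"
begin

definition sym_matrices :: "(real^'n^'n) set" where
  "sym_matrices = {M. transpose M = M}"

definition eigenvalue_of :: "real^'n^'n \<Rightarrow> real \<Rightarrow> bool" where
  "eigenvalue_of A \<mu> \<longleftrightarrow> (\<exists>w. w \<noteq> 0 \<and> A *v w = \<mu> *\<^sub>R w)"

definition pucci_matrices :: "real \<Rightarrow> real \<Rightarrow> (real^'n^'n) set" where
  "pucci_matrices l L = {A \<in> sym_matrices. \<forall>\<mu>. eigenvalue_of A \<mu> \<longrightarrow> l \<le> \<mu> \<and> \<mu> \<le> L}"

(* Sign convention: the operators are built from - Tr (A M), so that P applied to the Hessian
   behaves like minus the Laplacian.  For 0 < l \<le> L the index set is nonempty and bounded, so the
   supremum and infimum in the conditionally complete lattice of the reals are genuine. *)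
definition pucci_plus :: "real \<Rightarrow> real \<Rightarrow> real^'n^'n \<Rightarrow> real" where
  "pucci_plus l L M = (SUP A\<in>pucci_matrices l L. - trace (A ** M))"

definition pucci_minus :: "real \<Rightarrow> real \<Rightarrow> real^'n^'n \<Rightarrow> real" where
  "pucci_minus l L M = (INF A\<in>pucci_matrices l L. - trace (A ** M))"

(* f is of class C^2 on the open set S, with gradient G and Hessian H there. *)
definition C2_with :: "(real^'n) set \<Rightarrow> (real^'n \<Rightarrow> real) \<Rightarrow> (real^'n \<Rightarrow> real^'n)
    \<Rightarrow> (real^'n \<Rightarrow> real^'n^'n) \<Rightarrow> bool" where
  "C2_with S f G H \<longleftrightarrow>
     (\<forall>x\<in>S. (f has_derivative (\<lambda>h. G x \<bullet> h)) (at x)) \<and>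
     (\<forall>x\<in>S. (G has_derivative (\<lambda>h. H x *v h)) (at x)) \<and>
     continuous_on S H"

(* Near each boundary point, after a rotation taking e to the last coordinate direction, the set is
   the region strictly above the graph of a C^2 function of the other coordinates.  The vector
   x - (x \<bullet> e) e is the orthogonal projection of x to the hyperplane orthogonal to e; only the
   values of g on that hyperplane matter, and a C^2 function on it is the restriction of a C^2
   function on the whole space. *)
definition C2_boundary :: "(real^'n) set \<Rightarrow> bool" where
  "C2_boundary \<Omega> \<longleftrightarrow> (\<forall>x0\<in>frontier \<Omega>. \<exists>\<rho>>0. \<exists>e g G H. norm e = 1 \<and> C2_with UNIV g G H \<and>
     \<Omega> \<inter> ball x0 \<rho> = {x \<in> ball x0 \<rho>. x \<bullet> e > g (x - (x \<bullet> e) *\<^sub>R e)})"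

definition bounded_C2_domain :: "(real^'n) set \<Rightarrow> bool" where
  "bounded_C2_domain \<Omega> \<longleftrightarrow>
     open \<Omega> \<and> connected \<Omega> \<and> \<Omega> \<noteq> {} \<and> bounded \<Omega> \<and> C2_boundary \<Omega>"

definition local_max_in :: "(real^'n) set \<Rightarrow> (real^'n \<Rightarrow> real) \<Rightarrow> real^'n \<Rightarrow> bool" where
  "local_max_in \<Omega> w x0 \<longleftrightarrow> (\<exists>\<epsilon>>0. \<forall>x\<in>\<Omega> \<inter> ball x0 \<epsilon>. w x \<le> w x0)"

definition local_min_in :: "(real^'n) set \<Rightarrow> (real^'n \<Rightarrow> real) \<Rightarrow> real^'n \<Rightarrow> bool" where
  "local_min_in \<Omega> w x0 \<longleftrightarrow> (\<exists>\<epsilon>>0. \<forall>x\<in>\<Omega> \<inter> ball x0 \<epsilon>. w x0 \<le> w x)"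

type_synonym 'n operator = "real^'n^'n \<Rightarrow> real^'n \<Rightarrow> real \<Rightarrow> real^'n \<Rightarrow> real"

(* One equation F(D^2 w, D w, w, x) = h(x), read in the viscosity sense; for the systems below
   h(x) = f_i (u(x), v(x)). *)
definition visc_sub :: "(real^'n) set \<Rightarrow> 'n operator \<Rightarrow> (real^'n \<Rightarrow> real) \<Rightarrow> (real^'n \<Rightarrow> real) \<Rightarrow> bool" where
  "visc_sub \<Omega> F w h \<longleftrightarrow>
     (\<forall>\<phi> G H x0. C2_with \<Omega> \<phi> G H \<and> x0 \<in> \<Omega> \<and> local_max_in \<Omega> (\<lambda>x. w x - \<phi> x) x0
        \<longrightarrow> F (H x0) (G x0) (w x0) x0 \<le> h x0)"

definition visc_super :: "(real^'n) set \<Rightarrow> 'n operator \<Rightarrow> (real^'n \<Rightarrow> real) \<Rightarrow> (real^'n \<Rightarrow> real) \<Rightarrow> bool" where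
  "visc_super \<Omega> F w h \<longleftrightarrow>
     (\<forall>\<phi> G H x0. C2_with \<Omega> \<phi> G H \<and> x0 \<in> \<Omega> \<and> local_min_in \<Omega> (\<lambda>x. w x - \<phi> x) x0
        \<longrightarrow> F (H x0) (G x0) (w x0) x0 \<ge> h x0)"

definition system_subsolution :: "(real^'n) set \<Rightarrow> 'n operator \<Rightarrow> (real \<Rightarrow> real \<Rightarrow> real)
    \<Rightarrow> (real \<Rightarrow> real \<Rightarrow> real) \<Rightarrow> (real^'n \<Rightarrow> real) \<Rightarrow> (real^'n \<Rightarrow> real) \<Rightarrow> bool" where
  "system_subsolution \<Omega> F f1 f2 u v \<longleftrightarrow>
     continuous_on (closure \<Omega>) u \<and> continuous_on (closure \<Omega>) v \<and>
     visc_sub \<Omega> F u (\<lambda>x. f1 (u x) (v x)) \<and> visc_sub \<Omega> F v (\<lambda>x. f2 (u x) (v x))"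

definition system_supersolution :: "(real^'n) set \<Rightarrow> 'n operator \<Rightarrow> (real \<Rightarrow> real \<Rightarrow> real)
    \<Rightarrow> (real \<Rightarrow> real \<Rightarrow> real) \<Rightarrow> (real^'n \<Rightarrow> real) \<Rightarrow> (real^'n \<Rightarrow> real) \<Rightarrow> bool" where
  "system_supersolution \<Omega> F f1 f2 u v \<longleftrightarrow>
     continuous_on (closure \<Omega>) u \<and> continuous_on (closure \<Omega>) v \<and>
     visc_super \<Omega> F u (\<lambda>x. f1 (u x) (v x)) \<and> visc_super \<Omega> F v (\<lambda>x. f2 (u x) (v x))"

definition system_solution :: "(real^'n) set \<Rightarrow> 'n operator \<Rightarrow> (real \<Rightarrow> real \<Rightarrow> real)
    \<Rightarrow> (real \<Rightarrow> real \<Rightarrow> real) \<Rightarrow> (real^'n \<Rightarrow> real) \<Rightarrow> (real^'n \<Rightarrow> real)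
    \<Rightarrow> (real^'n \<Rightarrow> real) \<Rightarrow> (real^'n \<Rightarrow> real) \<Rightarrow> bool" where
  "system_solution \<Omega> F f1 f2 b1 b2 u v \<longleftrightarrow>
     system_subsolution \<Omega> F f1 f2 u v \<and> system_supersolution \<Omega> F f1 f2 u v \<and>
     (\<forall>x\<in>frontier \<Omega>. u x = b1 x \<and> v x = b2 x)"

end

theory Submission
  imports Defs
begin

text \<open>
  Let \<open>d\<close> be the distance to the complement of the domain. The proof is a bootstrap that alternates
  between the two equations and estimates \<open>u\<close> and \<open>v\<close> by powers of \<open>d\<close>. It ends with an equation
  whose right-hand side is at least \<open>k w powr (- s) * d powr (- b)\<close> with \<open>b \<ge> 2\<close>, and such an
  equation has no positive solution that vanishes on the boundary
  (\<open>no_supersolution_inverse_square\<close>). Four estimates carry the argument, each by comparison with an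
  explicit barrier.

  \<^item> \<open>supersolution_interior_lower_bound\<close>: if \<open>F \<ge> k w powr (- s) * d powr (- b)\<close>, then
  \<open>w \<ge> c d powr \<alpha>\<close> for every \<open>\<alpha> \<ge> 0\<close> with \<open>\<alpha> (1 + s) + b \<ge> 2\<close>. The barrier is a paraboloid on the
  ball with half the distance as radius. For \<open>b \<ge> 2\<close> one may take \<open>\<alpha> = 0\<close>, which is the final
  contradiction.
  \<^item> \<open>supersolution_linear_lower_bound\<close>: the Hopf bound \<open>w \<ge> c d\<close> when \<open>F \<ge> k > 0\<close>.
  \<^item> \<open>subsolution_power_upper_bound\<close>: if \<open>F \<le> k w powr (- p) * d powr (- b)\<close> and \<open>\<alpha> (1 + p) + b \<le> 2\<close>
  with \<open>0 < \<alpha> < 1\<close>, then \<open>w \<le> A d powr \<alpha>\<close>.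
  \<^item> \<open>subsolution_linear_upper_bound\<close>: if instead \<open>p + b < 1\<close>, then \<open>w \<le> A d\<close>.

  The distance \<open>d\<close> is never differentiated. Near a boundary point it is comparable to the height \<open>h\<close>
  above the graph that describes the boundary, and upper barriers are concave functions of \<open>h\<close>. Two
  devices keep the comparison elementary. Barriers are localised by adding or subtracting a multiple of
  \<open>|x - x0|\<^sup>2\<close> and then evaluated at \<open>x0\<close> itself, so that the localisation costs nothing. And at a
  touching point the barrier is replaced by a quadratic polynomial on the correct side of it, with
  Hessian \<open>a I - b z z\<^sup>T\<close>; on such matrices the Pucci operators are estimated directly.

  The conditions on the exponents come in two pairs that are exchanged by interchanging \<open>u\<close> and \<open>v\<close>.
\<close>

section \<open>Pucci operators on multiples of the identity and rank-one matrices\<close>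

lemma mat_mult_vec: "mat a *v w = a *\<^sub>R (w :: real^'n)"
  by (simp add: matrix_vector_mult_def mat_def vec_eq_iff if_distrib[where f="\<lambda>x. x * _"] cong: if_cong)

lemma sym_matrices_form_commute:
  assumes "A \<in> sym_matrices"
  shows "y \<bullet> (A *v z) = z \<bullet> (A *v y)"
proof -
  have "y \<bullet> (A *v z) = (y v* A) \<bullet> z" by (simp add: dot_lmul_matrix)
  also have "y v* A = A *v y"
    using assms transpose_matrix_vector[of A y] by (simp add: sym_matrices_def)
  finally show ?thesis by (simp add: inner_commute)
qed

text \<open>
  The least value \<open>\<mu>\<close> of the form on the unit sphere is an eigenvalue. If the residual
  \<open>z = A w - \<mu> w\<close> at a minimiser \<open>w\<close> were nonzero, then a small step from \<open>w\<close> in the direction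
  \<open>- z\<close> would decrease the nonnegative form of \<open>A - \<mu> I\<close>, which vanishes at \<open>w\<close>.
\<close>

lemma least_eigenvalue_form:
  fixes A :: "real^'n^'n"
  assumes sym: "A \<in> sym_matrices"
  obtains \<mu> where "eigenvalue_of A \<mu>" "\<And>y. \<mu> * (y \<bullet> y) \<le> y \<bullet> (A *v y)"
proof -
  have cont: "continuous_on (sphere 0 1) (\<lambda>y. y \<bullet> (A *v y))"
    by (intro continuous_intros linear_continuous_on matrix_vector_mul_bounded_linear)
  have ne: "sphere (0::real^'n) 1 \<noteq> {}" by simp
  obtain w where w: "w \<in> sphere 0 1"
    and min: "\<And>y. y \<in> sphere 0 1 \<Longrightarrow> w \<bullet> (A *v w) \<le> y \<bullet> (A *v y)"
    using continuous_attains_inf[OF compact_sphere ne cont] by metis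
  define \<mu> where "\<mu> = w \<bullet> (A *v w)"
  have ww: "w \<bullet> w = 1" using w by (simp add: dot_square_norm)
  have form: "\<mu> * (y \<bullet> y) \<le> y \<bullet> (A *v y)" for y
  proof (cases "y = 0")
    case False
    have "\<mu> \<le> (y /\<^sub>R norm y) \<bullet> (A *v (y /\<^sub>R norm y))"
      unfolding \<mu>_def by (rule min) (use False in simp)
    also have "\<dots> = (y \<bullet> (A *v y)) / (norm y)\<^sup>2"
      by (simp add: matrix_vector_mult_scaleR power2_eq_square field_simps)
    finally show ?thesis
      using False by (simp add: field_simps dot_square_norm)
  qed simp
  have swap: "y \<bullet> (A *v z) = z \<bullet> (A *v y)" for y z
    using sym by (rule sym_matrices_form_commute)
  have "A *v w - \<mu> *\<^sub>R w = 0"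
  proof -
    define z where "z = A *v w - \<mu> *\<^sub>R w"
    define b where "b = z \<bullet> (A *v z) - \<mu> * (z \<bullet> z)"
    have b0: "b \<ge> 0" using form[of z] by (simp add: b_def)
    have quad: "0 \<le> 2 * t * (z \<bullet> z) + t\<^sup>2 * b" for t
    proof -
      have zz: "z \<bullet> (A *v w) = z \<bullet> z + \<mu> * (z \<bullet> w)"
        by (simp add: z_def inner_diff_right inner_diff_left)
      have "\<mu> * ((w + t *\<^sub>R z) \<bullet> (w + t *\<^sub>R z)) \<le> (w + t *\<^sub>R z) \<bullet> (A *v (w + t *\<^sub>R z))"
        by (rule form)
      then show ?thesis
        using zz swap[of w z] ww
        by (simp add: b_def \<mu>_def[symmetric] matrix_vector_right_distrib matrix_vector_mult_scaleR inner_add_left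
            inner_add_right algebra_simps power2_eq_square inner_commute)
    qed
    have "z \<bullet> z = 0"
    proof (rule ccontr)
      assume "z \<bullet> z \<noteq> 0"
      then have pos: "z \<bullet> z > 0" by (metis inner_ge_zero order_less_le)
      \<comment> \<open>nearly the minimiser of the quadratic in \<open>t\<close>; the summand 1 keeps the denominator positive when \<open>b = 0\<close>\<close>
      define t where "t = - (z \<bullet> z) / (b + 1)"
      have td: "t * (b + 1) = - (z \<bullet> z)" and "t < 0"
        using b0 pos by (auto simp: t_def field_simps)
      have "2 * t * (z \<bullet> z) + t\<^sup>2 * b = 2 * t * (z \<bullet> z) + t * (t * (b + 1)) - t\<^sup>2"
        by (simp add: power2_eq_square algebra_simps)
      also have "\<dots> = t * (z \<bullet> z) - t\<^sup>2" unfolding td by simp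
      also have "\<dots> < 0" using mult_neg_pos[OF \<open>t < 0\<close> pos] zero_le_power2[of t] by linarith
      finally show False using quad[of t] by linarith
    qed
    then show ?thesis by (simp add: z_def)
  qed
  then have "eigenvalue_of A \<mu>"
    unfolding eigenvalue_of_def using ww by (intro exI[of _ w]) auto
  then show thesis using form that by blast
qed

text \<open>
  This turns the eigenvalue bounds that define the class of matrices into bounds on the quadratic
  form. The upper bound is the lower bound for \<open>- A\<close>.
\<close>

lemma pucci_form_bounds:
  fixes A :: "real^'n^'n"
  assumes A: "A \<in> pucci_matrices l L"
  shows "l * (y \<bullet> y) \<le> y \<bullet> (A *v y)" "y \<bullet> (A *v y) \<le> L * (y \<bullet> y)"
proof -
  have sym: "A \<in> sym_matrices" and ev: "\<And>\<mu>. eigenvalue_of A \<mu> \<Longrightarrow> l \<le> \<mu> \<and> \<mu> \<le> L"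
    using A by (auto simp: pucci_matrices_def)
  obtain \<mu> where "eigenvalue_of A \<mu>" "\<mu> * (y \<bullet> y) \<le> y \<bullet> (A *v y)"
    using least_eigenvalue_form[OF sym] by metis
  then show "l * (y \<bullet> y) \<le> y \<bullet> (A *v y)"
    using ev[of \<mu>] by (smt (verit) inner_ge_zero mult_right_mono)
  have "- A \<in> sym_matrices" using sym by (auto simp: sym_matrices_def transpose_def vec_eq_iff)
  then obtain \<nu> where \<nu>: "eigenvalue_of (- A) \<nu>" "\<nu> * (y \<bullet> y) \<le> y \<bullet> (- A *v y)"
    using least_eigenvalue_form by metis
  have neg: "- A *v z = - (A *v z)" for z
    by (simp add: matrix_vector_mult_def vec_eq_iff sum_negf)
  have "eigenvalue_of A (- \<nu>)"
    using \<nu>(1) unfolding eigenvalue_of_def neg by (metis minus_equation_iff scaleR_minus_left)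
  then show "y \<bullet> (A *v y) \<le> L * (y \<bullet> y)"
    using ev[of "- \<nu>"] \<nu>(2) unfolding neg by (smt (verit) inner_ge_zero inner_minus_right mult_right_mono mult_minus_left)
qed

lemma trace_pucci_le:
  fixes A :: "real^'n^'n"
  assumes A: "A \<in> pucci_matrices l L"
  shows "trace A \<le> real CARD('n) * L"
proof -
  have "A $ i $ i \<le> L" for i
    using pucci_form_bounds(2)[OF A, of "axis i 1"]
    by (simp add: matrix_vector_mul_component inner_axis inner_axis' )
  then show ?thesis unfolding trace_def
    by (rule sum_bounded_above[where A=UNIV, simplified])
qed

lemma pucci_matrices_nonempty:
  assumes "0 < l" "l \<le> L"
  shows "pucci_matrices l L \<noteq> ({} :: (real^'n^'n) set)"
proof -
  have "(mat l :: real^'n^'n) \<in> pucci_matrices l L"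
    using assms by (auto simp: pucci_matrices_def sym_matrices_def eigenvalue_of_def mat_mult_vec transpose_mat)
  then show ?thesis by blast
qed

definition outer :: "real^'n \<Rightarrow> real^'n^'n" where
  "outer z = (\<chi> i j. z $ i * z $ j)"

lemma outer_mult_vec: "outer z *v w = (z \<bullet> w) *\<^sub>R z"
  by (simp add: outer_def matrix_vector_mult_def vec_eq_iff inner_vec_def sum_distrib_left mult_ac)

lemma sym_shifted_outer: "mat a - b *\<^sub>R outer z \<in> sym_matrices"
  by (auto simp: sym_matrices_def transpose_def outer_def mat_def vec_eq_iff)

lemma form_shifted_outer:
  "y \<bullet> ((mat a - b *\<^sub>R outer z) *v y) = a * (y \<bullet> y) - b * (z \<bullet> y)\<^sup>2"
proof -
  have "(mat a - b *\<^sub>R outer z) *v y = a *\<^sub>R y - b *\<^sub>R ((z \<bullet> y) *\<^sub>R z)"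
    by (simp add: matrix_vector_mult_diff_rdistrib mat_mult_vec outer_mult_vec
        scaleR_matrix_vector_assoc[symmetric])
  then show ?thesis
    by (simp add: inner_diff_right power2_eq_square inner_commute)
qed

lemma trace_mult_shifted_outer:
  "trace (A ** (mat a - b *\<^sub>R outer z)) = a * trace A - b * (z \<bullet> (A *v z))"
proof -
  have "trace (A ** (mat a - b *\<^sub>R outer z))
      = (\<Sum>i\<in>UNIV. \<Sum>k\<in>UNIV. A$i$k * (if k = i then a else 0)) 
        - (\<Sum>i\<in>UNIV. \<Sum>k\<in>UNIV. A$i$k * (b * (z$k * z$i)))"
    by (simp add: trace_def matrix_matrix_mult_def outer_def mat_def right_diff_distrib sum_subtractf)
  also have "(\<Sum>i\<in>UNIV. \<Sum>k\<in>UNIV. A$i$k * (if k = i then a else 0)) = a * trace A"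
    by (simp add: trace_def sum_distrib_left mult.commute if_distrib cong: if_cong)
  also have "(\<Sum>i\<in>UNIV. \<Sum>k\<in>UNIV. A$i$k * (b * (z$k * z$i))) = b * (z \<bullet> (A *v z))"
    by (simp add: inner_vec_def matrix_vector_mult_def sum_distrib_left mult_ac)
  finally show ?thesis .
qed

text \<open>
  The barriers for subsolutions have Hessians of the form \<open>a I - b z z\<^sup>T\<close>: the rank-one part
  comes from the concavity of the barrier across the boundary and contributes at least
  \<open>b l |z|\<^sup>2\<close>, while all other second-order terms are absorbed in \<open>a I\<close>, whose cost is at most
  \<open>a N L\<close>.
\<close>

lemma pucci_minus_shifted_outer:
  fixes z :: "real^'n"
  assumes "0 < l" "l \<le> L" "0 \<le> a" "0 \<le> b"
  shows "b * l * (z \<bullet> z) - a * (real CARD('n) * L) \<le> pucci_minus l L (mat a - b *\<^sub>R outer z)"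
  unfolding pucci_minus_def
proof (rule cINF_greatest)
  show "pucci_matrices l L \<noteq> ({} :: (real^'n^'n) set)" using assms pucci_matrices_nonempty by blast
  fix A :: "real^'n^'n" assume A: "A \<in> pucci_matrices l L"
  have "b * (l * (z \<bullet> z)) \<le> b * (z \<bullet> (A *v z))"
    using pucci_form_bounds(1)[OF A] assms by (intro mult_left_mono) auto
  moreover have "a * trace A \<le> a * (real CARD('n) * L)"
    using trace_pucci_le[OF A] assms by (intro mult_left_mono) auto
  ultimately show "b * l * (z \<bullet> z) - a * (real CARD('n) * L) \<le> - trace (A ** (mat a - b *\<^sub>R outer z))"
    by (simp add: trace_mult_shifted_outer)
qed

lemma pucci_plus_neg_mat:
  assumes "0 < l" "l \<le> L" "0 \<le> a"
  shows "pucci_plus l L (mat (- a) :: real^'n^'n) \<le> a * (real CARD('n) * L)"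
  unfolding pucci_plus_def
proof (rule cSUP_least)
  show "pucci_matrices l L \<noteq> ({} :: (real^'n^'n) set)" using assms pucci_matrices_nonempty by blast
  fix A :: "real^'n^'n" assume A: "A \<in> pucci_matrices l L"
  have "a * trace A \<le> a * (real CARD('n) * L)"
    using trace_pucci_le[OF A] assms by (intro mult_left_mono) auto
  then show "- trace (A ** mat (- a)) \<le> a * (real CARD('n) * L)"
    using trace_mult_shifted_outer[of A "- a" 0 0] by simp
qed

section \<open>Quadratic test functions\<close>

text \<open>
  Quadratic polynomials are the only test functions used below. They are smooth on the whole space,
  so that barriers which make sense only close to a boundary point need no extension, and their
  Hessians are symmetric by construction, as the ellipticity conditions require.
\<close>

lemma C2_with_quadratic:
  fixes M :: "real^'n^'n"
  assumes "M \<in> sym_matrices"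
  shows "C2_with S (\<lambda>x. \<xi> \<bullet> (x - x0) + (x - x0) \<bullet> (M *v (x - x0)) / 2)
           (\<lambda>x. \<xi> + M *v (x - x0)) (\<lambda>x. M)"
proof -
  have swap: "y \<bullet> (M *v z) = z \<bullet> (M *v y)" for y z
    using assms by (rule sym_matrices_form_commute)
  have lin: "((\<lambda>x. M *v (x - x0)) has_derivative (\<lambda>h. M *v h)) (at x)" for x
    by (auto intro!: derivative_eq_intros bounded_linear.has_derivative[OF matrix_vector_mul_bounded_linear])
  show ?thesis
    unfolding C2_with_def
  proof (intro conjI ballI)
    fix x
    have "((\<lambda>x. \<xi> \<bullet> (x - x0) + (x - x0) \<bullet> (M *v (x - x0)) / 2) has_derivative
        (\<lambda>h. \<xi> \<bullet> h + ((x - x0) \<bullet> (M *v h) + h \<bullet> (M *v (x - x0))) / 2)) (at x)"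
      by (rule derivative_eq_intros lin refl | simp)+
    then show "((\<lambda>x. \<xi> \<bullet> (x - x0) + (x - x0) \<bullet> (M *v (x - x0)) / 2) has_derivative
        (\<lambda>h. (\<xi> + M *v (x - x0)) \<bullet> h)) (at x)"
      using swap[of "x - x0"] by (simp add: inner_add_left inner_add_right inner_commute)
    show "((\<lambda>x. \<xi> + M *v (x - x0)) has_derivative (\<lambda>h. M *v h)) (at x)"
      by (auto intro!: derivative_eq_intros lin)
  qed simp
qed

lemma visc_sub_jet:
  fixes M :: "real^'n^'n"
  assumes "visc_sub \<Omega> F w f" "x0 \<in> \<Omega>" "M \<in> sym_matrices" "e > 0"
    and "\<And>x. x \<in> \<Omega> \<Longrightarrow> dist x0 x < e \<Longrightarrow>
           w x \<le> w x0 + \<xi> \<bullet> (x - x0) + (x - x0) \<bullet> (M *v (x - x0)) / 2"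
  shows "F M \<xi> (w x0) x0 \<le> f x0"
proof -
  have "local_max_in \<Omega> (\<lambda>x. w x - (\<xi> \<bullet> (x - x0) + (x - x0) \<bullet> (M *v (x - x0)) / 2)) x0"
    unfolding local_max_in_def using assms(4,5) by (intro exI[of _ e]) (auto simp: algebra_simps)
  from assms(1)[unfolded visc_sub_def, rule_format, OF conjI[OF C2_with_quadratic[OF assms(3)] conjI[OF assms(2) this]]]
  show ?thesis by simp
qed

lemma visc_super_jet:
  fixes M :: "real^'n^'n"
  assumes "visc_super \<Omega> F w f" "x0 \<in> \<Omega>" "M \<in> sym_matrices" "e > 0"
    and "\<And>x. x \<in> \<Omega> \<Longrightarrow> dist x0 x < e \<Longrightarrow>
           w x0 + \<xi> \<bullet> (x - x0) + (x - x0) \<bullet> (M *v (x - x0)) / 2 \<le> w x"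
  shows "f x0 \<le> F M \<xi> (w x0) x0"
proof -
  have "local_min_in \<Omega> (\<lambda>x. w x - (\<xi> \<bullet> (x - x0) + (x - x0) \<bullet> (M *v (x - x0)) / 2)) x0"
    unfolding local_min_in_def using assms(4,5) by (intro exI[of _ e]) (auto simp: algebra_simps)
  from assms(1)[unfolded visc_super_def, rule_format, OF conjI[OF C2_with_quadratic[OF assms(3)] conjI[OF assms(2) this]]]
  show ?thesis by simp
qed

section \<open>Charts of a $C^2$ boundary\<close>

lemma norm_matrix_vector_le: "norm (M *v h) \<le> real CARD('n) * norm M * norm h" for M :: "real^'m^'n"
proof -
  have "norm (M *v h) \<le> (\<Sum>i\<in>UNIV. \<bar>(M *v h) $ i\<bar>)" by (rule norm_le_l1_cart)
  also have "\<dots> \<le> (\<Sum>i\<in>(UNIV::'n set). norm M * norm h)"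
  proof (rule sum_mono)
    fix i
    have "\<bar>(M *v h) $ i\<bar> = \<bar>M $ i \<bullet> h\<bar>" by (simp add: matrix_vector_mul_component)
    also have "\<dots> \<le> norm (M $ i) * norm h" by (rule Cauchy_Schwarz_ineq2)
    also have "\<dots> \<le> norm M * norm h" by (intro mult_right_mono Finite_Cartesian_Product.norm_nth_le) auto
    finally show "\<bar>(M *v h) $ i\<bar> \<le> norm M * norm h" .
  qed
  finally show ?thesis by simp
qed

lemma C2_gradient_lipschitz:
  assumes C2: "C2_with UNIV g G H" and S: "compact S" "convex S"
  obtains B where "B \<ge> 0" "\<And>x y. x \<in> S \<Longrightarrow> y \<in> S \<Longrightarrow> norm (G x - G y) \<le> B * norm (x - y)"
proof -
  have "compact (H ` S)"
    using C2 S by (auto simp: C2_with_def intro!: compact_continuous_image continuous_on_subset[of UNIV])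
  then obtain b where b: "b > 0" "\<And>x. x \<in> S \<Longrightarrow> norm (H x) \<le> b"
    using compact_imp_bounded bounded_pos by (metis imageI)
  define B where "B = real CARD('a) * b"
  have "norm (G x - G y) \<le> B * norm (x - y)" if "x \<in> S" "y \<in> S" for x y
  proof (rule differentiable_bound[OF S(2) _ _ that])
    fix z assume z: "z \<in> S"
    show "(G has_derivative (\<lambda>h. H z *v h)) (at z within S)"
      using C2 by (auto simp: C2_with_def intro: has_derivative_at_withinI)
    show "onorm (\<lambda>h. H z *v h) \<le> B"
    proof (rule onorm_le)
      fix h
      have "norm (H z *v h) \<le> real CARD('a) * norm (H z) * norm h" by (rule norm_matrix_vector_le)
      also have "\<dots> \<le> B * norm h" unfolding B_def
        using b(2)[OF z] by (intro mult_right_mono mult_left_mono) auto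
      finally show "norm (H z *v h) \<le> B * norm h" .
    qed
  qed
  moreover have "B \<ge> 0" using b by (simp add: B_def)
  ultimately show thesis using that by blast
qed

text \<open>
  A substitute for the distance to the boundary near the point \<open>y\<close>: a defining function \<open>h\<close> with
  gradient \<open>\<zeta>\<close>, where one constant \<open>K\<close> bounds the gradient, the error of its first-order
  expansions, and the ratio of \<open>h\<close> to the distance to the complement. First-order expansions with quadratic error are all the
  regularity that quadratic test functions can see, so second derivatives do not appear.
\<close>

definition boundary_chart ::
    "(real^'n) set \<Rightarrow> real^'n \<Rightarrow> real \<Rightarrow> real \<Rightarrow> (real^'n \<Rightarrow> real) \<Rightarrow> (real^'n \<Rightarrow> real^'n) \<Rightarrow> bool" where
  "boundary_chart \<Omega> y \<rho> K h \<zeta> \<longleftrightarrow> 0 < \<rho> \<and> 1 \<le> K \<and> continuous_on (ball y \<rho>) h \<and>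
     (\<forall>x\<in>ball y \<rho>. (x \<in> \<Omega> \<longleftrightarrow> 0 < h x) \<and> 1 \<le> norm (\<zeta> x) \<and> norm (\<zeta> x) \<le> K \<and>
        (x \<in> \<Omega> \<longrightarrow> infdist x (- \<Omega>) \<le> h x \<and> h x \<le> K * infdist x (- \<Omega>))) \<and>
     (\<forall>x\<in>ball y \<rho>. \<forall>x1\<in>ball y \<rho>. \<bar>h x - h x1 - \<zeta> x1 \<bullet> (x - x1)\<bar> \<le> K * (norm (x - x1))\<^sup>2)"

lemma boundary_chart_mono:
  assumes "boundary_chart \<Omega> y \<rho> K h \<zeta>" "0 < \<rho>'" "\<rho>' \<le> \<rho>"
  shows "boundary_chart \<Omega> y \<rho>' K h \<zeta>"
proof -
  have sub: "ball y \<rho>' \<subseteq> ball y \<rho>" using assms(3) by (rule subset_ball)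
  have "continuous_on (ball y \<rho>') h"
    using assms(1) sub unfolding boundary_chart_def by (meson continuous_on_subset)
  then show ?thesis using assms(1,2) sub unfolding boundary_chart_def by (meson subsetD)
qed

text \<open>
  Take the height \<open>h x = x \<bullet> e - g (P x)\<close> above the graph, where \<open>P\<close> is the projection along \<open>e\<close>.
  Its gradient \<open>e - P (\<nabla>g (P x))\<close> has component 1 in the direction \<open>e\<close>, which bounds it from below;
  it is Lipschitz because the Hessian of \<open>g\<close> is bounded on compact sets. Descending by \<open>h x\<close> in the
  direction \<open>- e\<close> leads out of the domain, so the distance is at most \<open>h x\<close>; conversely \<open>h\<close> is
  Lipschitz and nonpositive at the nearest point of the complement. The radius is halved so that
  both points lie in the ball where the graph describes the domain.
\<close>

lemma boundary_chart_exists: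
  fixes \<Omega> :: "(real^'n) set"
  assumes bdry: "C2_boundary \<Omega>" and op: "open \<Omega>" and y: "y \<in> frontier \<Omega>"
  obtains \<rho> K h \<zeta> where "boundary_chart \<Omega> y \<rho> K h \<zeta>"
proof -
  obtain \<rho> e g G H where \<rho>: "\<rho> > 0" and e: "norm e = 1" and C2: "C2_with UNIV g G H"
    and \<Omega>: "\<Omega> \<inter> ball y \<rho> = {x \<in> ball y \<rho>. x \<bullet> e > g (x - (x \<bullet> e) *\<^sub>R e)}"
    using bdry[unfolded C2_boundary_def, rule_format, OF y] by blast
  define P where "P = (\<lambda>x::real^'n. x - (x \<bullet> e) *\<^sub>R e)"
  define h where "h = (\<lambda>x. x \<bullet> e - g (P x))"
  define \<zeta> where "\<zeta> = (\<lambda>x. e - P (G (P x)))"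
  have ee: "e \<bullet> e = 1" using e by (simp add: dot_square_norm)
  have Pdiff: "P a - P b = P (a - b)" for a b by (simp add: P_def inner_diff_left algebra_simps)
  have Pe: "P v \<bullet> e = 0" for v by (simp add: P_def inner_diff_left ee)
  have Psa: "a \<bullet> P b = P a \<bullet> b" for a b by (simp add: P_def inner_diff_left inner_diff_right inner_commute)
  have Pn: "norm (P v) \<le> norm v" for v
  proof -
    have "(norm (P v))\<^sup>2 = (norm v)\<^sup>2 - (v \<bullet> e)\<^sup>2"
      unfolding power2_norm_eq_inner
      by (simp add: P_def inner_diff_left inner_diff_right ee power2_eq_square inner_commute)
    then have "(norm (P v))\<^sup>2 \<le> (norm v)\<^sup>2" by simp
    then show ?thesis by (rule power2_le_imp_le) simp
  qed
  have Pline: "P (x - t *\<^sub>R e) = P x" for x t by (simp add: P_def inner_diff_left ee algebra_simps)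
  obtain B where B: "B \<ge> 0"
      "\<And>a b. a \<in> cball (P y) \<rho> \<Longrightarrow> b \<in> cball (P y) \<rho> \<Longrightarrow> norm (G a - G b) \<le> B * norm (a - b)"
    using C2_gradient_lipschitz[OF C2 compact_cball convex_cball] by metis
  have Pball: "P x \<in> cball (P y) \<rho>" if "x \<in> ball y \<rho>" for x
    using that Pn[of "y - x"] by (auto simp: dist_norm Pdiff)
  have \<zeta>lip: "norm (\<zeta> a - \<zeta> b) \<le> B * norm (a - b)" if "a \<in> ball y \<rho>" "b \<in> ball y \<rho>" for a b
  proof -
    have "norm (\<zeta> a - \<zeta> b) = norm (P (G (P b) - G (P a)))" by (simp add: \<zeta>_def Pdiff[symmetric])
    also have "\<dots> \<le> B * norm (P b - P a)"
      using Pn B(2)[OF Pball[OF that(2)] Pball[OF that(1)]] order_trans by blast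
    also have "\<dots> \<le> B * norm (b - a)" using Pn[of "b - a"] B(1) by (simp add: Pdiff mult_left_mono)
    finally show ?thesis by (simp add: norm_minus_commute)
  qed
  have hder: "(h has_derivative (\<lambda>v. \<zeta> x \<bullet> v)) (at x)" for x
  proof -
    have P': "(P has_derivative P) (at x)" unfolding P_def by (rule derivative_eq_intros refl | simp)+
    have g': "(g has_derivative (\<lambda>v. G (P x) \<bullet> v)) (at (P x))" using C2 by (simp add: C2_with_def)
    have "((\<lambda>x. g (P x)) has_derivative (\<lambda>v. G (P x) \<bullet> P v)) (at x)"
      using has_derivative_compose[OF P' g'] .
    then have "(h has_derivative (\<lambda>v. v \<bullet> e - G (P x) \<bullet> P v)) (at x)"
      unfolding h_def by (auto intro!: derivative_eq_intros)
    moreover have "v \<bullet> e - G (P x) \<bullet> P v = \<zeta> x \<bullet> v" for v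
      by (simp add: \<zeta>_def Psa inner_diff_left inner_commute[of v e])
    ultimately show ?thesis by simp
  qed
  define K where "K = max 1 (norm (\<zeta> y) + B * \<rho>)"
  have K1: "1 \<le> K" by (simp add: K_def)
  have \<zeta>1: "1 \<le> norm (\<zeta> x)" for x
  proof -
    have "\<zeta> x \<bullet> e = 1" by (simp add: \<zeta>_def inner_diff_left Pe ee)
    then show ?thesis using Cauchy_Schwarz_ineq2[of "\<zeta> x" e] e by simp
  qed
  have \<zeta>K: "norm (\<zeta> x) \<le> K" if "x \<in> ball y \<rho>" for x
  proof -
    have "norm (\<zeta> x) \<le> norm (\<zeta> y) + norm (\<zeta> x - \<zeta> y)" by (metis norm_triangle_sub add.commute)
    also have "\<dots> \<le> norm (\<zeta> y) + B * norm (x - y)" using \<zeta>lip[OF that, of y] \<rho> by simp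
    also have "\<dots> \<le> norm (\<zeta> y) + B * \<rho>"
      using that B(1) by (auto simp: dist_norm norm_minus_commute intro!: mult_left_mono)
    finally show ?thesis by (simp add: K_def)
  qed
  have hlip: "\<bar>h a - h b\<bar> \<le> K * norm (a - b)" if "a \<in> ball y \<rho>" "b \<in> ball y \<rho>" for a b
  proof -
    have "norm (h a - h b) \<le> K * norm (a - b)"
    proof (rule differentiable_bound[OF convex_ball _ _ that])
      fix z assume z: "z \<in> ball y \<rho>"
      show "(h has_derivative (\<lambda>v. \<zeta> z \<bullet> v)) (at z within ball y \<rho>)"
        using hder by (rule has_derivative_at_withinI)
      show "onorm (\<lambda>v. \<zeta> z \<bullet> v) \<le> K"
      proof (rule onorm_le)
        fix v
        have "norm (\<zeta> z \<bullet> v) \<le> norm (\<zeta> z) * norm v" by (simp add: Cauchy_Schwarz_ineq2)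
        also have "\<dots> \<le> K * norm v" using \<zeta>K[OF z] by (intro mult_right_mono) auto
        finally show "norm (\<zeta> z \<bullet> v) \<le> K * norm v" .
      qed
    qed
    then show ?thesis by simp
  qed
  have taylor: "\<bar>h x - h x1 - \<zeta> x1 \<bullet> (x - x1)\<bar> \<le> B * (norm (x - x1))\<^sup>2"
    if x: "x \<in> ball y \<rho>" and x1: "x1 \<in> ball y \<rho>" for x x1
  proof -
    have seg: "closed_segment x1 x \<subseteq> ball y \<rho>"
      using x x1 by (simp add: closed_segment_subset)
    have "norm ((h x - \<zeta> x1 \<bullet> x) - (h x1 - \<zeta> x1 \<bullet> x1)) \<le> (B * norm (x - x1)) * norm (x - x1)"
    proof (rule differentiable_bound[where S="closed_segment x1 x" and f="\<lambda>x. h x - \<zeta> x1 \<bullet> x"])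
      fix z assume z: "z \<in> closed_segment x1 x"
      show "((\<lambda>x. h x - \<zeta> x1 \<bullet> x) has_derivative (\<lambda>v. \<zeta> z \<bullet> v - \<zeta> x1 \<bullet> v)) (at z within closed_segment x1 x)"
        by (rule derivative_eq_intros has_derivative_at_withinI[OF hder] refl | simp)+
      have zz: "norm (\<zeta> z - \<zeta> x1) \<le> B * norm (x - x1)"
      proof -
        have "norm (\<zeta> z - \<zeta> x1) \<le> B * norm (z - x1)" using \<zeta>lip z seg x1 by auto
        also have "\<dots> \<le> B * norm (x - x1)"
          using B(1) segment_bound1[OF z] by (intro mult_left_mono) (auto simp: norm_minus_commute)
        finally show ?thesis .
      qed
      show "onorm (\<lambda>v. \<zeta> z \<bullet> v - \<zeta> x1 \<bullet> v) \<le> B * norm (x - x1)"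
      proof (rule onorm_le)
        fix v
        have "norm (\<zeta> z \<bullet> v - \<zeta> x1 \<bullet> v) \<le> norm (\<zeta> z - \<zeta> x1) * norm v"
          by (simp add: inner_diff_left[symmetric] Cauchy_Schwarz_ineq2)
        also have "\<dots> \<le> (B * norm (x - x1)) * norm v" using zz by (intro mult_right_mono) auto
        finally show "norm (\<zeta> z \<bullet> v - \<zeta> x1 \<bullet> v) \<le> (B * norm (x - x1)) * norm v" .
      qed
    qed auto
    moreover have "(h x - \<zeta> x1 \<bullet> x) - (h x1 - \<zeta> x1 \<bullet> x1) = h x - h x1 - \<zeta> x1 \<bullet> (x - x1)"
      by (simp add: inner_diff_right)
    ultimately show ?thesis by (simp only: power2_eq_square mult.assoc real_norm_def)
  qed
  have yn: "y \<notin> \<Omega>" using y op by (simp add: frontier_def interior_open)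
  have in\<Omega>: "x \<in> \<Omega> \<longleftrightarrow> 0 < h x" if "x \<in> ball y \<rho>" for x
  proof -
    have "x \<in> \<Omega> \<longleftrightarrow> x \<in> \<Omega> \<inter> ball y \<rho>" using that by blast
    also have "\<dots> \<longleftrightarrow> 0 < h x" unfolding \<Omega> using that by (simp add: h_def P_def)
    finally show ?thesis .
  qed
  have ne: "- \<Omega> \<noteq> {}" using yn by auto
  have cl: "closed (- \<Omega>)" using op by (rule closed_Compl)
  have dist_le: "infdist x (- \<Omega>) \<le> h x \<and> h x \<le> K * infdist x (- \<Omega>)"
    if x: "x \<in> ball y (\<rho>/2)" and x\<Omega>: "x \<in> \<Omega>" for x
  proof
    have dy: "infdist x (- \<Omega>) < \<rho>/2"
      using infdist_le[of y "- \<Omega>" x] yn x by (auto simp: dist_commute)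
    have xb: "x \<in> ball y \<rho>" using x \<rho> by auto
    show "infdist x (- \<Omega>) \<le> h x"
    proof (rule ccontr)
      assume "\<not> ?thesis"
      then have hx: "h x < infdist x (- \<Omega>)" by simp
      have hpos: "0 < h x" using in\<Omega>[OF xb] x\<Omega> by simp
      define z where "z = x - h x *\<^sub>R e"
      have dz: "dist x z = h x" using hpos e by (simp add: z_def dist_norm)
      have "dist y z < \<rho>" using dist_triangle[of y z x] dz hx dy x by auto
      moreover have "h z = 0" by (simp add: z_def h_def Pline inner_diff_left ee)
      ultimately have "z \<notin> \<Omega>" using in\<Omega>[of z] by auto
      then show False using infdist_le[of z "- \<Omega>" x] dz hx by auto
    qed
    obtain z where z: "z \<in> - \<Omega>" "infdist x (- \<Omega>) = dist x z"
      using infdist_attains_inf[OF cl ne] by metis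
    have zb: "z \<in> ball y \<rho>" using dist_triangle[of y z x] z dy x by auto
    have "h z \<le> 0" using in\<Omega>[OF zb] z by auto
    then show "h x \<le> K * infdist x (- \<Omega>)" using hlip[OF xb zb] z(2) by (simp add: dist_norm)
  qed
  have "boundary_chart \<Omega> y (\<rho>/2) (max K B) h \<zeta>"
    unfolding boundary_chart_def
  proof (intro conjI ballI impI)
    show "continuous_on (ball y (\<rho>/2)) h"
      using hder by (meson continuous_at_imp_continuous_on has_derivative_continuous)
    fix x assume x: "x \<in> ball y (\<rho>/2)"
    then have xb: "x \<in> ball y \<rho>" using \<rho> by auto
    show "(x \<in> \<Omega>) = (0 < h x)" by (rule in\<Omega>[OF xb])
    show "1 \<le> norm (\<zeta> x)" by (rule \<zeta>1)
    show "norm (\<zeta> x) \<le> max K B" using \<zeta>K[OF xb] by simp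
    { assume "x \<in> \<Omega>"
      then show "infdist x (- \<Omega>) \<le> h x" using dist_le[OF x] by simp
      have "h x \<le> K * infdist x (- \<Omega>)" using dist_le[OF x \<open>x \<in> \<Omega>\<close>] by simp
      also have "\<dots> \<le> max K B * infdist x (- \<Omega>)" by (intro mult_right_mono infdist_nonneg) auto
      finally show "h x \<le> max K B * infdist x (- \<Omega>)" . }
    fix x1 assume "x1 \<in> ball y (\<rho>/2)"
    then have "\<bar>h x - h x1 - \<zeta> x1 \<bullet> (x - x1)\<bar> \<le> B * (norm (x - x1))\<^sup>2" using taylor xb \<rho> by auto
    also have "\<dots> \<le> max K B * (norm (x - x1))\<^sup>2" by (intro mult_right_mono) auto
    finally show "\<bar>h x - h x1 - \<zeta> x1 \<bullet> (x - x1)\<bar> \<le> max K B * (norm (x - x1))\<^sup>2" .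
  qed (use \<rho> K1 in auto)
  then show thesis by (rule that)
qed

section \<open>Quadratic majorants of concave profiles\<close>

text \<open>
  The second derivative of the difference is negative at \<open>s\<close>, so its first derivative changes sign
  there from positive to negative. The strict inequality between \<open>g2\<close> and \<open>- k\<close> makes the
  inequality exact instead of having a Taylor remainder.
\<close>

lemma quadratic_majorant:
  fixes G G1 :: "real \<Rightarrow> real"
  assumes "d0 > 0" and G: "\<And>t. \<bar>t - s\<bar> < d0 \<Longrightarrow> (G has_real_derivative G1 t) (at t)"
    and G1: "(G1 has_real_derivative g2) (at s)" and "g2 < - k"
  obtains d where "d > 0" "\<And>z. \<bar>z\<bar> < d \<Longrightarrow> G (s + z) \<le> G s + G1 s * z - k / 2 * z\<^sup>2"
proof -
  define D where "D = (\<lambda>t. G1 t - G1 s + k * (t - s))"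
  define Q where "Q = (\<lambda>t. G t - G s - G1 s * (t - s) + k / 2 * (t - s)\<^sup>2)"
  have D: "(D has_real_derivative (g2 + k)) (at s)"
    unfolding D_def by (rule derivative_eq_intros G1 refl | simp)+
  have neg: "g2 + k < 0" using assms(4) by simp
  obtain d1 where d1: "d1 > 0" "\<And>z. 0 < z \<Longrightarrow> z < d1 \<Longrightarrow> D (s + z) < D s"
    using DERIV_neg_dec_right[OF D neg] by metis
  obtain d2 where d2: "d2 > 0" "\<And>z. 0 < z \<Longrightarrow> z < d2 \<Longrightarrow> D s < D (s - z)"
    using DERIV_neg_dec_left[OF D neg] by metis
  have Ds: "D s = 0" by (simp add: D_def)
  define d where "d = min d0 (min d1 d2)"
  have Q': "(Q has_real_derivative D t) (at t)" if "\<bar>t - s\<bar> < d" for t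
  proof -
    have "(G has_real_derivative G1 t) (at t)" using G that by (simp add: d_def)
    then show ?thesis unfolding Q_def D_def
      by (auto intro!: derivative_eq_intros simp: field_simps)
  qed
  have mono: "Q (s + z) \<le> Q s" if "\<bar>z\<bar> < d" for z
  proof (cases "z \<ge> 0")
    case True
    show ?thesis
    proof (rule DERIV_nonpos_imp_nonincreasing[where f=Q and a=s and b="s + z"])
      fix t assume "s \<le> t" "t \<le> s + z"
      then show "\<exists>y. (Q has_real_derivative y) (at t) \<and> y \<le> 0"
        using Q'[of t] d1(2)[of "t - s"] Ds that by (cases "t = s") (auto simp: d_def)
    qed (use True in simp)
  next
    case False
    show ?thesis
    proof (rule DERIV_nonneg_imp_nondecreasing[where f=Q and a="s + z" and b=s])
      fix t assume "s + z \<le> t" "t \<le> s"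
      then show "\<exists>y. (Q has_real_derivative y) (at t) \<and> 0 \<le> y"
        using Q'[of t] d2(2)[of "s - t"] Ds that by (cases "t = s") (auto simp: d_def)
    qed (use False in simp)
  qed
  have "G (s + z) \<le> G s + G1 s * z - k / 2 * z\<^sup>2" if "\<bar>z\<bar> < d" for z
    using mono[OF that] by (simp add: Q_def)
  moreover have "d > 0" using assms(1) d1 d2 by (simp add: d_def)
  ultimately show thesis using that by blast
qed

text \<open>
  Second-order expansion from above of the composition of a concave profile \<open>G\<close> with a chart. Here
  \<open>\<eta>\<close> is the increment of the chart and \<open>\<zeta> \<bullet> y\<close> its linear part. The negative square of \<open>\<eta>\<close> is
  replaced by half the negative square of \<open>\<zeta> \<bullet> y\<close>, at the price of a fourth-order error, which
  \<open>\<epsilon> |y|\<^sup>2\<close> dominates close to 0.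
\<close>

lemma parabola_through_chart:
  assumes G: "\<And>z. \<bar>z\<bar> < d \<Longrightarrow> G (s + z) \<le> G s + g1 * z - k / 2 * z\<^sup>2" and "0 < d" "0 \<le> g1" "0 < k" "0 < \<epsilon>"
    and K: "1 \<le> K" and z: "norm \<zeta> \<le> K"
  obtains e where "0 < e"
    "\<And>y \<eta>. norm y < e \<Longrightarrow> \<bar>\<eta> - \<zeta> \<bullet> y\<bar> \<le> K * (norm y)\<^sup>2 \<Longrightarrow>
       G (s + \<eta>) \<le> G s + g1 * (\<zeta> \<bullet> y) + (g1 * K + \<epsilon>) * (norm y)\<^sup>2 - k / 4 * (\<zeta> \<bullet> y)\<^sup>2"
proof
  define e where "e = min 1 (min (d / (2 * K)) (sqrt (\<epsilon> / (k * K\<^sup>2))))"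
  show "0 < e" using assms by (simp add: e_def)
  fix y \<eta> assume y: "norm y < e" and \<eta>: "\<bar>\<eta> - \<zeta> \<bullet> y\<bar> \<le> K * (norm y)\<^sup>2"
  define n where "n = norm y"
  define r where "r = \<eta> - \<zeta> \<bullet> y"
  have n: "0 \<le> n" "n < 1" "n < d / (2 * K)" "n < sqrt (\<epsilon> / (k * K\<^sup>2))" using y by (simp_all add: e_def n_def)
  have nn: "n\<^sup>2 \<le> n" using n by (simp add: power2_eq_square mult_left_le)
  have r: "\<bar>r\<bar> \<le> K * n\<^sup>2" using \<eta> by (simp add: r_def n_def)
  have "\<bar>\<zeta> \<bullet> y\<bar> \<le> K * n"
    unfolding n_def by (rule order_trans[OF Cauchy_Schwarz_ineq2]) (use z in \<open>simp add: mult_right_mono\<close>)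
  moreover have "\<bar>r\<bar> \<le> K * n" using r nn K by (smt (verit) mult_left_mono)
  ultimately have "\<bar>\<eta>\<bar> \<le> 2 * K * n" by (simp add: r_def)
  also have "\<dots> < d" using n(3) K by (simp add: field_simps)
  finally have "G (s + \<eta>) \<le> G s + g1 * \<eta> - k / 2 * \<eta>\<^sup>2" by (rule G)
  moreover have "g1 * \<eta> \<le> g1 * (\<zeta> \<bullet> y + K * n\<^sup>2)"
    using r assms(3) by (intro mult_left_mono) (auto simp: r_def)
  moreover have "k / 2 * \<eta>\<^sup>2 \<ge> k / 4 * (\<zeta> \<bullet> y)\<^sup>2 - \<epsilon> * n\<^sup>2"
  proof -
    have "(\<zeta> \<bullet> y)\<^sup>2 \<le> 2 * \<eta>\<^sup>2 + 2 * r\<^sup>2"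
      using zero_le_power2[of "\<eta> + r"] by (simp add: r_def power2_eq_square algebra_simps)
    then have "k / 4 * (\<zeta> \<bullet> y)\<^sup>2 \<le> k / 4 * (2 * \<eta>\<^sup>2 + 2 * r\<^sup>2)"
      using assms(4) by (intro mult_left_mono) auto
    moreover have "k * r\<^sup>2 \<le> \<epsilon> * n\<^sup>2"
    proof -
      have "r\<^sup>2 \<le> (K * n\<^sup>2)\<^sup>2" using r by (metis abs_ge_zero power2_abs power_mono)
      then have "k * r\<^sup>2 \<le> k * (K * n\<^sup>2)\<^sup>2" using assms(4) by simp
      also have "\<dots> = (k * K\<^sup>2 * n\<^sup>2) * n\<^sup>2" by (simp add: power2_eq_square mult_ac)
      also have "\<dots> \<le> \<epsilon> * n\<^sup>2"
      proof (rule mult_right_mono)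
        have "n\<^sup>2 \<le> (sqrt (\<epsilon> / (k * K\<^sup>2)))\<^sup>2" using n by (intro power_mono) auto
        also have "\<dots> = \<epsilon> / (k * K\<^sup>2)" using assms by simp
        finally show "k * K\<^sup>2 * n\<^sup>2 \<le> \<epsilon>" using assms(4) K by (simp add: field_simps)
      qed simp
      finally show ?thesis .
    qed
    moreover have "0 \<le> \<epsilon> * n\<^sup>2" using assms(5) by simp
    ultimately show ?thesis by (simp add: field_simps)
  qed
  ultimately show "G (s + \<eta>) \<le> G s + g1 * (\<zeta> \<bullet> y) + (g1 * K + \<epsilon>) * (norm y)\<^sup>2 - k / 4 * (\<zeta> \<bullet> y)\<^sup>2"
    unfolding n_def[symmetric] by (simp add: ring_distribs)
qed

text \<open>
  This passes from estimates near each point of the closed domain, with constants depending on that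
  point, to one constant for the whole domain.
\<close>

lemma locally_bounded_above_on_compact:
  fixes f :: "'a::metric_space \<Rightarrow> real"
  assumes S: "compact S" and loc: "\<And>y. y \<in> S \<Longrightarrow> \<exists>\<rho>>0. \<exists>A. \<forall>x\<in>X \<inter> ball y \<rho>. f x \<le> A"
    and "X \<subseteq> S"
  obtains A where "A > 0" "\<And>x. x \<in> X \<Longrightarrow> f x \<le> A"
proof -
  obtain \<rho> A where \<rho>: "\<And>y. y \<in> S \<Longrightarrow> \<rho> y > (0::real)"
    and A: "\<And>y x. y \<in> S \<Longrightarrow> x \<in> X \<inter> ball y (\<rho> y) \<Longrightarrow> f x \<le> A y"
    using loc by metis
  have "S \<subseteq> (\<Union>y\<in>S. ball y (\<rho> y))" using \<rho> by auto
  then obtain T where T: "T \<subseteq> S" "finite T" "S \<subseteq> (\<Union>y\<in>T. ball y (\<rho> y))"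
    using compactE_image[OF S, of S "\<lambda>y. ball y (\<rho> y)"] by auto
  show thesis
  proof
    show "0 < 1 + (\<Sum>y\<in>T. \<bar>A y\<bar>)" by (simp add: sum_nonneg add_pos_nonneg)
    fix x assume x: "x \<in> X"
    then obtain y where y: "y \<in> T" "x \<in> ball y (\<rho> y)" using T \<open>X \<subseteq> S\<close> by blast
    then have "f x \<le> A y" using A T x by blast
    also have "\<dots> \<le> (\<Sum>y\<in>T. \<bar>A y\<bar>)"
      using member_le_sum[of y T "\<lambda>y. \<bar>A y\<bar>"] y T by auto
    finally show "f x \<le> 1 + (\<Sum>y\<in>T. \<bar>A y\<bar>)" by simp
  qed
qed

text \<open>
  The next two estimates exchange upper and lower bounds by powers of the distance when a component
  of the system enters the other equation with a negative exponent.
\<close>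

lemma powr_neg_ge_of_upper:
  fixes w :: real
  assumes "0 < w" "w \<le> A * d powr \<alpha>" "0 < A" "0 < d" "0 \<le> r"
  shows "A powr (- r) * d powr (- (\<alpha> * r)) \<le> w powr (- r)"
proof -
  have "(A * d powr \<alpha>) powr (- r) \<le> w powr (- r)" using assms by (intro powr_mono2') auto
  then show ?thesis using assms by (simp add: powr_mult powr_powr)
qed

lemma powr_neg_le_of_lower:
  fixes w :: real
  assumes "c * d powr \<alpha> \<le> w" "0 < c" "0 < d" "0 \<le> r"
  shows "w powr (- r) \<le> c powr (- r) * d powr (- (\<alpha> * r))"
proof -
  have "w powr (- r) \<le> (c * d powr \<alpha>) powr (- r)" using assms by (intro powr_mono2') auto
  then show ?thesis using assms by (simp add: powr_mult powr_powr)
qed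

section \<open>Operators between Pucci operators\<close>

lemma norm_diff_sq_expand:
  fixes x :: "'a::real_inner"
  shows "(norm (x - x0))\<^sup>2 = (norm (x1 - x0))\<^sup>2 + 2 * ((x1 - x0) \<bullet> (x - x1)) + (norm (x - x1))\<^sup>2"
  by (simp add: power2_norm_eq_inner inner_diff_left inner_diff_right inner_commute)

lemma form_mat: "y \<bullet> (mat a *v y) = a * (norm y)\<^sup>2"
  by (simp add: mat_mult_vec power2_norm_eq_inner)

text \<open>
  The operator satisfies the two-sided bound by Pucci operators and vanishes at the zero function,
  which is what positive homogeneity contributes. Since viscosity solutions are compared with
  quadratic polynomials only, these bounds replace any regularity theory or comparison principle for
  the operator.
\<close>

locale elliptic_dirichlet =
  fixes \<Omega> :: "(real^'n) set" and F :: "'n operator" and l L \<Gamma> \<gamma> :: real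
  assumes domain: "bounded_C2_domain \<Omega>"
    and ell: "0 < l" "l \<le> L" and \<Gamma>: "0 \<le> \<Gamma>" and \<gamma>: "0 \<le> \<gamma>"
    and F_zero: "x \<in> \<Omega> \<Longrightarrow> F 0 0 0 x = 0"
    and F_lower: "M \<in> sym_matrices \<Longrightarrow> M' \<in> sym_matrices \<Longrightarrow> x \<in> \<Omega> \<Longrightarrow>
          pucci_minus l L (M - M') - \<Gamma> * norm (\<xi> - \<xi>') - \<gamma> * max (z' - z) 0
            \<le> F M \<xi> z x - F M' \<xi>' z' x"
    and F_upper: "M \<in> sym_matrices \<Longrightarrow> M' \<in> sym_matrices \<Longrightarrow> x \<in> \<Omega> \<Longrightarrow>
          F M \<xi> z x - F M' \<xi>' z' x
            \<le> pucci_plus l L (M - M') + \<Gamma> * norm (\<xi> - \<xi>') + \<gamma> * max (- (z' - z)) 0"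
begin

abbreviation bdist :: "real^'n \<Rightarrow> real" where "bdist x \<equiv> infdist x (- \<Omega>)"

lemma card_L_nonneg: "0 \<le> (real CARD('n) * L)" using ell by simp

lemma F_shifted_outer_ge:
  assumes "x \<in> \<Omega>" "0 \<le> a" "0 \<le> b" "0 \<le> z"
  shows "b * l * (\<zeta> \<bullet> \<zeta>) - a * (real CARD('n) * L) - \<Gamma> * norm \<xi> \<le> F (mat a - b *\<^sub>R outer \<zeta>) \<xi> z x"
proof -
  have "(0 :: real^'n^'n) \<in> sym_matrices" by (auto simp: sym_matrices_def transpose_def vec_eq_iff)
  from F_lower[OF sym_shifted_outer this assms(1), of a b \<zeta> \<xi> 0 0 z]
  show ?thesis
    using pucci_minus_shifted_outer[OF ell assms(2,3), of \<zeta>] F_zero[OF assms(1)] assms(4) by simp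
qed

lemma F_neg_mat_le:
  assumes "x \<in> \<Omega>" "0 \<le> a" "0 \<le> z"
  shows "F (mat (- a)) \<xi> z x \<le> a * (real CARD('n) * L) + \<Gamma> * norm \<xi> + \<gamma> * z"
proof -
  have "(0 :: real^'n^'n) \<in> sym_matrices" by (auto simp: sym_matrices_def transpose_def vec_eq_iff)
  moreover have "(mat (- a) :: real^'n^'n) \<in> sym_matrices" using sym_shifted_outer[of "- a" 0] by simp
  ultimately show ?thesis
    using F_upper[of "mat (- a)" 0 x \<xi> z 0 0] assms
      pucci_plus_neg_mat[OF ell assms(2), where 'n='n] F_zero[OF assms(1)] by simp
qed

lemma open_domain: "open \<Omega>" and bounded_domain: "bounded \<Omega>" and nonempty_domain: "\<Omega> \<noteq> {}"
  and C2_domain: "C2_boundary \<Omega>"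
  using domain by (auto simp: bounded_C2_domain_def)

lemma Compl_nonempty: "- \<Omega> \<noteq> {}"
  using bounded_domain not_bounded_UNIV[where 'a="real^'n"] by (metis Compl_empty_eq double_compl)

lemma frontier_domain_nonempty: "frontier \<Omega> \<noteq> {}"
  using frontier_not_empty[OF nonempty_domain] Compl_nonempty by auto

lemma compact_closure_domain: "compact (closure \<Omega>)"
  using bounded_domain by simp

lemma closure_domain_cases: "x \<in> closure \<Omega> \<longleftrightarrow> x \<in> \<Omega> \<or> x \<in> frontier \<Omega>"
  using open_domain closure_subset by (auto simp: frontier_def interior_open)

lemma bdist_pos: "x \<in> \<Omega> \<Longrightarrow> 0 < bdist x"
  using infdist_pos_not_in_closed[OF closed_Compl[OF open_domain] Compl_nonempty, of x] by simp

lemma in_domain_if_close: "dist x z < bdist x \<Longrightarrow> z \<in> \<Omega>"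
  using infdist_le[of z "- \<Omega>" x] by fastforce

lemma bdist_triangle: "bdist x \<le> bdist z + dist x z"
  by (rule infdist_triangle)

lemma bdist_bounded:
  obtains T where "1 \<le> T" "\<And>x. x \<in> \<Omega> \<Longrightarrow> bdist x \<le> T"
proof -
  obtain y where y: "y \<notin> \<Omega>" using Compl_nonempty by auto
  obtain b where b: "\<And>x. x \<in> \<Omega> \<Longrightarrow> dist y x \<le> b"
    using bounded_domain bounded_any_center[of \<Omega> y] by auto
  show thesis
  proof
    fix x assume "x \<in> \<Omega>"
    then show "bdist x \<le> max 1 b" using b[of x] infdist_le[of y "- \<Omega>" x] y by (auto simp: dist_commute)
  qed simp
qed

lemma continuous_bounded_above:
  assumes "continuous_on (closure \<Omega>) w"
  obtains W where "(1::real) \<le> W" "\<And>x. x \<in> \<Omega> \<Longrightarrow> w x \<le> W"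
proof -
  have "closure \<Omega> \<noteq> {}" using nonempty_domain by simp
  then obtain z where "\<And>x. x \<in> closure \<Omega> \<Longrightarrow> w x \<le> w z"
    using continuous_attains_sup[OF compact_closure_domain _ assms] by metis
  then have "w x \<le> max 1 (w z)" if "x \<in> \<Omega>" for x
    using that closure_subset by (meson max.coboundedI2 subsetD)
  then show thesis using that[of "max 1 (w z)"] by simp
qed

section \<open>Lower bounds for supersolutions\<close>

text \<open>
  A lower bound by scaling. If \<open>x0\<close> has distance \<open>t\<close> to the complement, then the right-hand side is at
  least of order \<open>w powr (- s) * t powr (- b)\<close> on the ball of radius \<open>t/2\<close>. The paraboloid of height
  \<open>m = a t powr \<alpha>\<close> vanishing on the boundary of this ball has Hessian of order \<open>m / t\<^sup>2\<close>. If \<open>w x0 < m\<close>,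
  then the paraboloid, shifted down, touches \<open>w\<close> from below at a point where \<open>w < m\<close>, and the equation
  there compares \<open>a powr (- s) t powr (- \<alpha> s - b)\<close> with \<open>a t powr (\<alpha> - 2)\<close>. The
  condition on \<open>\<alpha>\<close> says that the first power of \<open>t\<close> is at least the second one for \<open>t \<le> 1\<close>, so a small \<open>a\<close>
  gives a contradiction.
\<close>

lemma supersolution_interior_lower_bound:
  assumes vs: "visc_super \<Omega> F w f" and cont: "continuous_on (closure \<Omega>) w"
    and pos: "\<And>x. x \<in> \<Omega> \<Longrightarrow> 0 < w x"
    and f: "\<And>x. x \<in> \<Omega> \<Longrightarrow> k * w x powr (- s) * bdist x powr (- b) \<le> f x"
    and k: "0 < k" and s: "0 \<le> s" and b: "0 \<le> b" and \<alpha>: "0 \<le> \<alpha>" "2 \<le> \<alpha> * (1 + s) + b"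
  obtains c where "0 < c" "\<And>x. x \<in> \<Omega> \<Longrightarrow> c * bdist x powr \<alpha> \<le> w x"
proof -
  obtain T where T: "1 \<le> T" "\<And>x. x \<in> \<Omega> \<Longrightarrow> bdist x \<le> T" using bdist_bounded by metis
  define e where "e = \<alpha> * (1 + s) + b - 2"
  \<comment> \<open>bounds \<open>F\<close> on the paraboloid in units of its height divided by \<open>t\<^sup>2\<close>\<close>
  define D where "D = 8 * (real CARD('n) * L) + 4 * \<Gamma> * T + \<gamma> * T\<^sup>2 + 1"
  have D: "0 < D" using card_L_nonneg \<Gamma> \<gamma> T(1) by (auto simp: D_def intro!: add_nonneg_pos)
  have e: "0 \<le> e" using \<alpha> by (simp add: e_def)
  have Te: "0 < T powr e" using T by simp
  define a where "a = min 1 (k * 2 powr (- b) / (2 * D * T powr e))"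
  have a: "0 < a" "a \<le> 1" using k D Te by (auto simp: a_def)
  have "a * (2 * D * T powr e) \<le> k * 2 powr (- b) / (2 * D * T powr e) * (2 * D * T powr e)"
    unfolding a_def using D Te by (intro mult_right_mono) auto
  then have "2 * (a * D * T powr e) \<le> k * 2 powr (- b)" using D Te by (simp add: mult_ac)
  moreover have "0 < a * D * T powr e" using a D Te by simp
  ultimately have asmall: "a * D * T powr e < k * 2 powr (- b)" by linarith
  have "a * bdist x0 powr \<alpha> \<le> w x0" if x0: "x0 \<in> \<Omega>" for x0
  proof (rule ccontr)
    assume contra: "\<not> ?thesis"
    define t where "t = bdist x0"
    have t: "0 < t" "t \<le> T" using bdist_pos[OF x0] T(2)[OF x0] by (simp_all add: t_def)
    define m where "m = a * t powr \<alpha>"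
    have m: "0 < m" "w x0 < m" using contra a t by (simp_all add: m_def t_def)
    define c where "c = 4 * m / t\<^sup>2"
    have c: "0 < c" using m t by (simp add: c_def)
    define \<psi> where "\<psi> = (\<lambda>x. m - c * (norm (x - x0))\<^sup>2)"
    have sub: "cball x0 (t/2) \<subseteq> \<Omega>" using in_domain_if_close[of x0] t by (auto simp: t_def)
    have \<psi>cont: "continuous_on (cball x0 (t/2)) (\<lambda>x. w x - \<psi> x)"
      unfolding \<psi>_def using sub closure_subset[of \<Omega>]
      by (intro continuous_intros continuous_on_subset[OF cont]) auto
    have "cball x0 (t/2) \<noteq> {}" using t by simp
    then obtain x1 where x1: "x1 \<in> cball x0 (t/2)"
      and min: "\<And>x. x \<in> cball x0 (t/2) \<Longrightarrow> w x1 - \<psi> x1 \<le> w x - \<psi> x"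
      using continuous_attains_inf[OF compact_cball _ \<psi>cont] by blast
    have x1\<Omega>: "x1 \<in> \<Omega>" using x1 sub by auto
    have w1: "0 < w x1" by (rule pos[OF x1\<Omega>])
    have "w x1 - \<psi> x1 < 0" using min[of x0] m t by (simp add: \<psi>_def)
    then have below: "w x1 < \<psi> x1" by simp
    then have wm: "w x1 < m" using c by (smt (verit) \<psi>_def mult_nonneg_nonneg zero_le_power2)
    have "norm (x1 - x0) \<noteq> t/2"
    proof
      assume "norm (x1 - x0) = t/2"
      then have "\<psi> x1 = m - 4 * m / t\<^sup>2 * (t / 2)\<^sup>2" by (simp only: \<psi>_def c_def)
      then have "\<psi> x1 = 0" using t by (simp add: power2_eq_square)
      then show False using below w1 by simp
    qed
    then have n1: "norm (x1 - x0) < t/2" using x1 by (simp add: dist_norm norm_minus_commute)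
    define \<xi> where "\<xi> = (- (2 * c)) *\<^sub>R (x1 - x0)"
    have "f x1 \<le> F (mat (- (2 * c))) \<xi> (w x1) x1"
    proof (rule visc_super_jet[OF vs x1\<Omega>])
      show "(mat (- (2 * c)) :: real^'n^'n) \<in> sym_matrices" using sym_shifted_outer[of "- (2 * c)" 0] by simp
      show "0 < t/2 - norm (x1 - x0)" using n1 by simp
      fix x assume "dist x1 x < t/2 - norm (x1 - x0)"
      then have "x \<in> cball x0 (t/2)"
        using dist_triangle[of x0 x x1] by (simp add: dist_norm norm_minus_commute)
      from min[OF this] have "w x1 + (\<psi> x - \<psi> x1) \<le> w x" by simp
      moreover have "\<psi> x - \<psi> x1 = - c * (2 * ((x1 - x0) \<bullet> (x - x1)) + (norm (x - x1))\<^sup>2)"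
        unfolding \<psi>_def norm_diff_sq_expand[of x x0 x1] by (simp add: ring_distribs)
      ultimately show "w x1 + \<xi> \<bullet> (x - x1) + (x - x1) \<bullet> (mat (- (2 * c)) *v (x - x1)) / 2 \<le> w x"
        by (simp add: \<xi>_def form_mat ring_distribs)
    qed
    also have "\<dots> \<le> (2 * c) * (real CARD('n) * L) + \<Gamma> * norm \<xi> + \<gamma> * w x1"
      using c w1 by (intro F_neg_mat_le x1\<Omega>) auto
    also have "\<dots> \<le> (2 * c) * (real CARD('n) * L) + \<Gamma> * (c * t) + \<gamma> * m"
    proof -
      have "norm \<xi> \<le> c * t" using n1 c by (simp add: \<xi>_def)
      then show ?thesis using \<Gamma> \<gamma> wm c by (intro add_mono mult_left_mono) auto
    qed
    also have "\<dots> = m / t\<^sup>2 * (8 * (real CARD('n) * L) + 4 * \<Gamma> * t + \<gamma> * t\<^sup>2)"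
      using t by (simp add: c_def field_simps power2_eq_square)
    also have "\<dots> \<le> m / t\<^sup>2 * D"
    proof -
      have "4 * \<Gamma> * t \<le> 4 * \<Gamma> * T" "\<gamma> * t\<^sup>2 \<le> \<gamma> * T\<^sup>2"
        using t \<Gamma> \<gamma> by (auto intro!: mult_left_mono power_mono)
      then show ?thesis using m t by (intro mult_left_mono) (auto simp: D_def)
    qed
    also have "m / t\<^sup>2 * D = a * D * t powr (\<alpha> - 2)"
      using t by (simp add: m_def powr_diff)
    finally have up: "f x1 \<le> a * D * t powr (\<alpha> - 2)" .
    have "bdist x1 \<le> 2 * t"
      using bdist_triangle[of x1 x0] n1 t by (simp add: t_def dist_norm)
    then have "(2 * t) powr (- b) \<le> bdist x1 powr (- b)"
      using bdist_pos[OF x1\<Omega>] b by (intro powr_mono2') auto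
    moreover have "t powr (- (\<alpha> * s)) \<le> w x1 powr (- s)"
    proof -
      have "t powr (- (\<alpha> * s)) = (t powr \<alpha>) powr (- s)" by (simp add: powr_powr)
      also have "\<dots> \<le> w x1 powr (- s)"
        using wm w1 s mult_right_mono[OF a(2), of "t powr \<alpha>"] by (intro powr_mono2') (auto simp: m_def)
      finally show ?thesis .
    qed
    ultimately have "k * t powr (- (\<alpha> * s)) * (2 * t) powr (- b) \<le> k * w x1 powr (- s) * bdist x1 powr (- b)"
      using k by (intro mult_mono) auto
    also have "\<dots> \<le> a * D * t powr (\<alpha> - 2)" using f[OF x1\<Omega>] up by simp
    finally have "k * 2 powr (- b) * t powr (- (\<alpha> * s) - b) \<le> a * D * t powr (\<alpha> - 2)"
      using t by (simp add: powr_mult powr_diff powr_minus field_simps)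
    then have "k * 2 powr (- b) * t powr (- (\<alpha> * s) - b) * t powr (\<alpha> * s + b)
        \<le> a * D * t powr (\<alpha> - 2) * t powr (\<alpha> * s + b)"
      by (rule mult_right_mono) simp
    then have "k * 2 powr (- b) \<le> a * D * t powr e"
      using t by (simp add: mult.assoc powr_add[symmetric] e_def algebra_simps)
    also have "\<dots> \<le> a * D * T powr e"
      using t a D e by (intro mult_left_mono powr_mono2) auto
    finally show False using asmall by simp
  qed
  then show thesis using that a(1) by blast
qed

text \<open>
  The case \<open>\<alpha> = 0\<close> of the previous estimate is a positive lower bound by a constant, which is
  incompatible with zero boundary values.
\<close>

lemma no_supersolution_inverse_square:
  assumes vs: "visc_super \<Omega> F w f" and cont: "continuous_on (closure \<Omega>) w"
    and pos: "\<And>x. x \<in> \<Omega> \<Longrightarrow> 0 < w x" and bv: "\<And>x. x \<in> frontier \<Omega> \<Longrightarrow> w x = 0"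
    and f: "\<And>x. x \<in> \<Omega> \<Longrightarrow> k * w x powr (- s) * bdist x powr (- b) \<le> f x"
    and "0 < k" "0 \<le> s" "2 \<le> b"
  shows False
proof -
  obtain c where c: "0 < c" "\<And>x. x \<in> \<Omega> \<Longrightarrow> c * bdist x powr 0 \<le> w x"
    using supersolution_interior_lower_bound[OF vs cont pos f, where \<alpha>=0] assms(6-8) by auto
  obtain y where y: "y \<in> frontier \<Omega>" using frontier_domain_nonempty by auto
  then have "y \<in> closure \<Omega>" by (simp add: frontier_def)
  moreover have "x \<in> \<Omega> \<Longrightarrow> c \<le> w x" for x using c(2)[of x] bdist_pos[of x] by simp
  ultimately have "c \<le> w y" by (rule continuous_ge_on_closure[OF cont])
  then show False using c(1) bv[OF y] by simp
qed

text \<open>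
  The Hopf estimate. Near a boundary point compare with \<open>a h x - b |x - x0|\<^sup>2\<close> at every \<open>x0\<close>: since
  \<open>a\<close> is a fixed small multiple of \<open>b\<close>, this is nonpositive on the boundary of the domain and on the
  sphere around \<open>x0\<close>, hence below \<open>w\<close> there. As \<open>F\<close> of it is at most a constant times \<open>b\<close> while the
  right-hand side is at least \<open>k > 0\<close>, small \<open>b\<close> rules out touching inside. At \<open>x0\<close> the penalty
  vanishes and leaves \<open>a h x0 \<le> w x0\<close>, with \<open>a\<close> independent of \<open>x0\<close>.
\<close>

lemma supersolution_linear_lower_bound:
  assumes vs: "visc_super \<Omega> F w f" and cont: "continuous_on (closure \<Omega>) w"
    and pos: "\<And>x. x \<in> \<Omega> \<Longrightarrow> 0 < w x" and bv: "\<And>x. x \<in> frontier \<Omega> \<Longrightarrow> w x = 0"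
    and f: "\<And>x. x \<in> \<Omega> \<Longrightarrow> k \<le> f x" and k: "0 < k"
  obtains c where "0 < c" "\<And>x. x \<in> \<Omega> \<Longrightarrow> c * bdist x \<le> w x"
proof -
  obtain T where T: "1 \<le> T" "\<And>x. x \<in> \<Omega> \<Longrightarrow> bdist x \<le> T" using bdist_bounded by metis
  have "\<exists>\<rho>>0. \<exists>A. \<forall>x\<in>\<Omega> \<inter> ball y \<rho>. bdist x / w x \<le> A" if "y \<in> closure \<Omega>" for y
  proof (cases "y \<in> \<Omega>")
    case True
    have "continuous_on \<Omega> w" using cont closure_subset continuous_on_subset by blast
    then have "isCont w y" using True open_domain continuous_on_eq_continuous_at by blast
    then obtain \<rho> where \<rho>: "\<rho> > 0" "\<And>x. dist x y < \<rho> \<Longrightarrow> dist (w x) (w y) < w y / 2"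
      using pos[OF True] unfolding continuous_at_eps_delta by (metis half_gt_zero)
    have "bdist x / w x \<le> T / (w y / 2)" if x: "x \<in> \<Omega> \<inter> ball y \<rho>" for x
    proof (rule frac_le)
      show "w y / 2 \<le> w x" using \<rho>(2)[of x] x by (auto simp: dist_commute dist_real_def abs_if split: if_splits)
    qed (use T x pos[OF True] in auto)
    then show ?thesis using \<rho>(1) by blast
  next
    case False
    then have y: "y \<in> frontier \<Omega>" using that closure_domain_cases by blast
    obtain \<rho> K h \<zeta> where chart: "boundary_chart \<Omega> y \<rho> K h \<zeta>"
      using boundary_chart_exists[OF C2_domain open_domain y] .
    have \<rho>: "0 < \<rho>" and K: "1 \<le> K" and hcont: "continuous_on (ball y \<rho>) h"
      and in\<Omega>: "\<And>x. x \<in> ball y \<rho> \<Longrightarrow> x \<in> \<Omega> \<longleftrightarrow> 0 < h x"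
      and \<zeta>: "\<And>x. x \<in> ball y \<rho> \<Longrightarrow> norm (\<zeta> x) \<le> K"
      and hd: "\<And>x. x \<in> ball y \<rho> \<Longrightarrow> x \<in> \<Omega> \<Longrightarrow> bdist x \<le> h x \<and> h x \<le> K * bdist x"
      and tay: "\<And>x x1. x \<in> ball y \<rho> \<Longrightarrow> x1 \<in> ball y \<rho> \<Longrightarrow>
            \<bar>h x - h x1 - \<zeta> x1 \<bullet> (x - x1)\<bar> \<le> K * (norm (x - x1))\<^sup>2"
      using chart by (simp_all add: boundary_chart_def)
    define \<sigma> where "\<sigma> = \<rho> / 2"
    have \<sigma>: "0 < \<sigma>" using \<rho> by (simp add: \<sigma>_def)
    define a' where "a' = \<sigma>\<^sup>2 / (K * \<rho>)"
    have a': "0 < a'" using \<sigma> K \<rho> by (simp add: a'_def)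
    define C where "C = 2 * (a' * K + 1) * (real CARD('n) * L) + \<Gamma> * (a' * K + 2 * \<sigma>) + \<gamma> * \<sigma>\<^sup>2 + 1"
    have C: "0 < C" unfolding C_def using a' K ell \<Gamma> \<gamma> \<sigma>
      by (intro add_nonneg_pos add_nonneg_nonneg mult_nonneg_nonneg) auto
    define b where "b = k / (2 * C)"
    have b: "0 < b" using k C by (simp add: b_def)
    have bC: "b * C < k" using k C by (simp add: b_def)
    define a where "a = b * a'"
    have a: "0 < a" using a' b by (simp add: a_def)
    have hsmall: "a * h x \<le> b * \<sigma>\<^sup>2" if "x \<in> ball y \<rho>" for x
    proof (cases "x \<in> \<Omega>")
      case True
      have "bdist x \<le> \<rho>" using infdist_le[of y "- \<Omega>" x] False that by (auto simp: dist_commute)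
      then have "h x \<le> K * \<rho>" using hd[OF that True] K by (smt (verit) mult_left_mono)
      then have "a * h x \<le> a * (K * \<rho>)" using a by simp
      also have "\<dots> = b * \<sigma>\<^sup>2" using K \<rho> by (simp add: a_def a'_def)
      finally show ?thesis .
    next
      case False
      then have "a * h x \<le> 0" using in\<Omega>[OF that] a by (simp add: mult_nonneg_nonpos)
      then show ?thesis using b by (smt (verit) mult_nonneg_nonneg zero_le_power2)
    qed
    have "bdist x0 / w x0 \<le> 1 / a" if "x0 \<in> \<Omega> \<inter> ball y \<sigma>" for x0
    proof -
      have x0: "x0 \<in> \<Omega>" "x0 \<in> ball y \<sigma>" using that by auto
      have sub: "cball x0 \<sigma> \<subseteq> ball y \<rho>"
      proof
        fix x assume "x \<in> cball x0 \<sigma>"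
        then show "x \<in> ball y \<rho>" using x0(2) dist_triangle[of y x x0] by (simp add: \<sigma>_def)
      qed
      have "a * h x0 \<le> w x0"
      proof (rule ccontr)
        assume contra: "\<not> ?thesis"
        define \<psi> where "\<psi> = (\<lambda>x. a * h x - b * (norm (x - x0))\<^sup>2)"
        define S where "S = closure \<Omega> \<inter> cball x0 \<sigma>"
        have "compact S" unfolding S_def using compact_closure_domain by (intro compact_Int) auto
        moreover have "continuous_on S (\<lambda>x. w x - \<psi> x)" unfolding \<psi>_def S_def
          using sub by (intro continuous_intros continuous_on_subset[OF cont] continuous_on_subset[OF hcont]) auto
        moreover have x0S: "x0 \<in> S" using x0 closure_subset \<sigma> by (auto simp: S_def)
        ultimately obtain x1 where x1: "x1 \<in> S" and min: "\<And>x. x \<in> S \<Longrightarrow> w x1 - \<psi> x1 \<le> w x - \<psi> x"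
          using continuous_attains_inf[of S "\<lambda>x. w x - \<psi> x"] by blast
        have below: "w x1 < \<psi> x1" using min[OF x0S] contra by (simp add: \<psi>_def)
        have x1b: "x1 \<in> ball y \<rho>" using x1 sub by (auto simp: S_def)
        have x1\<Omega>: "x1 \<in> \<Omega>"
        proof (rule ccontr)
          assume out: "x1 \<notin> \<Omega>"
          then have "w x1 = 0" using x1 bv closure_domain_cases by (auto simp: S_def)
          moreover have "a * h x1 \<le> 0" using out in\<Omega>[OF x1b] a by (simp add: mult_nonneg_nonpos)
          ultimately show False using below b by (smt (verit) \<psi>_def mult_nonneg_nonneg zero_le_power2)
        qed
        have w1: "0 < w x1" by (rule pos[OF x1\<Omega>])
        have n1: "norm (x1 - x0) < \<sigma>"
        proof (rule ccontr)
          assume "\<not> ?thesis"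
          then have "norm (x1 - x0) = \<sigma>" using x1 by (simp add: S_def dist_norm norm_minus_commute)
          then show False using below hsmall[OF x1b] w1 by (simp add: \<psi>_def)
        qed
        define q where "q = 2 * (a * K + b)"
        define \<xi> where "\<xi> = a *\<^sub>R \<zeta> x1 - (2 * b) *\<^sub>R (x1 - x0)"
        have "f x1 \<le> F (mat (- q)) \<xi> (w x1) x1"
        proof (rule visc_super_jet[OF vs x1\<Omega>])
          show "(mat (- q) :: real^'n^'n) \<in> sym_matrices" using sym_shifted_outer[of "- q" 0] by simp
          show "0 < \<sigma> - norm (x1 - x0)" using n1 by simp
          fix x assume x: "x \<in> \<Omega>" "dist x1 x < \<sigma> - norm (x1 - x0)"
          then have xS: "x \<in> S"
            using dist_triangle[of x0 x x1] closure_subset by (auto simp: S_def dist_norm norm_minus_commute)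
          then have "h x - h x1 - \<zeta> x1 \<bullet> (x - x1) \<ge> - (K * (norm (x - x1))\<^sup>2)"
            using tay[of x x1] x1b sub by (auto simp: S_def abs_le_iff)
          then have "a * (h x - h x1) \<ge> a * (\<zeta> x1 \<bullet> (x - x1) - K * (norm (x - x1))\<^sup>2)"
            using a by (intro mult_left_mono) auto
          moreover have "w x1 + (\<psi> x - \<psi> x1) \<le> w x" using min[OF xS] by simp
          moreover have "\<psi> x - \<psi> x1
              = a * (h x - h x1) - b * (2 * ((x1 - x0) \<bullet> (x - x1)) + (norm (x - x1))\<^sup>2)"
            unfolding \<psi>_def norm_diff_sq_expand[of x x0 x1] by (simp add: ring_distribs)
          moreover have "\<xi> \<bullet> (x - x1) = a * (\<zeta> x1 \<bullet> (x - x1)) - b * (2 * ((x1 - x0) \<bullet> (x - x1)))"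
            unfolding \<xi>_def inner_diff_left[of "a *\<^sub>R \<zeta> x1"] by simp
          moreover have "(x - x1) \<bullet> (mat (- q) *v (x - x1)) / 2
              = - (a * (K * (norm (x - x1))\<^sup>2)) - b * (norm (x - x1))\<^sup>2"
            by (simp add: q_def form_mat field_simps)
          ultimately show "w x1 + \<xi> \<bullet> (x - x1) + (x - x1) \<bullet> (mat (- q) *v (x - x1)) / 2 \<le> w x"
            unfolding ring_distribs by linarith
        qed
        also have "\<dots> \<le> q * (real CARD('n) * L) + \<Gamma> * norm \<xi> + \<gamma> * w x1"
          using a b K w1 by (intro F_neg_mat_le x1\<Omega>) (auto simp: q_def)
        also have "\<dots> \<le> q * (real CARD('n) * L) + \<Gamma> * (a * K + 2 * b * \<sigma>) + \<gamma> * (b * \<sigma>\<^sup>2)"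
        proof -
          have "norm \<xi> \<le> a * norm (\<zeta> x1) + 2 * b * norm (x1 - x0)"
            unfolding \<xi>_def by (rule order_trans[OF norm_triangle_ineq4]) (use a b in simp)
          also have "\<dots> \<le> a * K + 2 * b * \<sigma>"
            using a b \<zeta>[OF x1b] n1 by (intro add_mono mult_left_mono) auto
          finally have "norm \<xi> \<le> a * K + 2 * b * \<sigma>" .
          moreover have "w x1 \<le> b * \<sigma>\<^sup>2"
            using below hsmall[OF x1b] b by (smt (verit) \<psi>_def mult_nonneg_nonneg zero_le_power2)
          moreover have "0 \<le> q" using a b K by (simp add: q_def)
          ultimately show ?thesis using \<Gamma> \<gamma> by (intro add_mono mult_left_mono) auto
        qed
        also have "\<dots> \<le> b * C" using b by (simp add: a_def q_def C_def algebra_simps)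
        finally show False using f[OF x1\<Omega>] bC by simp
      qed
      moreover have "a * bdist x0 \<le> a * h x0"
        using hd[of x0] x0 \<rho> a by (intro mult_left_mono) (auto simp: \<sigma>_def)
      ultimately have "a * bdist x0 \<le> w x0" by linarith
      then show ?thesis using pos[OF x0(1)] a by (simp add: field_simps)
    qed
    then show ?thesis using \<sigma> by blast
  qed
  then obtain A where A: "A > 0" "\<And>x. x \<in> \<Omega> \<Longrightarrow> bdist x / w x \<le> A"
    using locally_bounded_above_on_compact[OF compact_closure_domain, of \<Omega> "\<lambda>x. bdist x / w x"] closure_subset
    by metis
  show thesis
  proof
    show "0 < 1 / A" using A by simp
    fix x assume "x \<in> \<Omega>"
    then show "1 / A * bdist x \<le> w x" using A(1) A(2)[of x] pos[of x] by (simp add: field_simps)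
  qed
qed

section \<open>Upper bounds for subsolutions\<close>

text \<open>
  Near a boundary point \<open>y\<close> the barrier is \<open>A G (h x) + B |x - x0|\<^sup>2\<close>, one for each \<open>x0\<close> close to \<open>y\<close>.
  The second term is at least \<open>w\<close> on a sphere around \<open>x0\<close> and vanishes at \<open>x0\<close>, so that the constants do
  not depend on \<open>x0\<close>. At a touching point with \<open>s = h x1\<close>, the concavity of \<open>G\<close> contributes a multiple
  of \<open>A G2 s\<close>. It dominates the terms with \<open>G1 s\<close> close to the boundary, because \<open>G1 / G2\<close> tends to 0
  there (assumption \<open>ratio\<close>). What remains is of order \<open>A s powr (- m)\<close>, whereas the right-hand side is
  at most of order \<open>s powr (- \<alpha> p - b)\<close>, because \<open>w\<close> lies above \<open>c s powr \<alpha>\<close> at that point; so a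
  large \<open>A\<close> excludes touching.

  The choice of constants is ordered: \<open>\<tau>\<close> makes the chart small enough for \<open>ratio\<close>, then \<open>B\<close> is fixed
  by the radius of the chart, and \<open>A\<close> comes last.
\<close>

lemma subsolution_upper_bound_by_profile:
  fixes G G1 G2 :: "real \<Rightarrow> real"
  assumes vs: "visc_sub \<Omega> F w f" and cont: "continuous_on (closure \<Omega>) w"
    and pos: "\<And>x. x \<in> \<Omega> \<Longrightarrow> 0 < w x" and bv: "\<And>x. x \<in> frontier \<Omega> \<Longrightarrow> w x = 0"
    and f: "\<And>x. x \<in> \<Omega> \<Longrightarrow> f x \<le> k * w x powr (- p) * bdist x powr (- b)"
    and k: "0 < k" and p: "0 \<le> p" and b: "0 \<le> b" and \<alpha>: "0 < \<alpha>" "\<alpha> * p + b \<le> m"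
    and \<tau>0: "0 < \<tau>0" "\<tau>0 \<le> 1" and Gcont: "continuous_on {0..\<tau>0} G"
    and G: "\<And>t. 0 \<le> t \<Longrightarrow> t \<le> \<tau>0 \<Longrightarrow> c * t powr \<alpha> \<le> G t \<and> G t \<le> c2 * t powr \<alpha>"
    and c: "0 < c" and c': "0 < c'"
    and G': "\<And>t. 0 < t \<Longrightarrow> t < \<tau>0 \<Longrightarrow> (G has_real_derivative G1 t) (at t)"
    and G'': "\<And>t. 0 < t \<Longrightarrow> t < \<tau>0 \<Longrightarrow> (G1 has_real_derivative - G2 t) (at t)"
    and G1: "\<And>t. 0 < t \<Longrightarrow> t < \<tau>0 \<Longrightarrow> 0 \<le> G1 t"
    and G2: "\<And>t. 0 < t \<Longrightarrow> t < \<tau>0 \<Longrightarrow> c' * t powr (- m) \<le> G2 t"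
    and ratio: "\<And>\<epsilon>. 0 < \<epsilon> \<Longrightarrow> \<exists>\<tau>>0. \<forall>t. 0 < t \<and> t < \<tau> \<longrightarrow> G1 t \<le> \<epsilon> * G2 t"
  obtains A where "0 < A" "\<And>x. x \<in> \<Omega> \<Longrightarrow> w x \<le> A * bdist x powr \<alpha>"
proof -
  obtain W where W: "1 \<le> W" and W\<Omega>: "\<And>x. x \<in> \<Omega> \<Longrightarrow> w x \<le> W"
    using continuous_bounded_above[OF cont] by metis
  have "0 \<le> c2" using G[of \<tau>0] \<tau>0 c by (smt (verit) mult_less_0_iff powr_gt_zero zero_less_mult_iff)
  have "\<exists>\<rho>>0. \<exists>A. \<forall>x\<in>\<Omega> \<inter> ball y \<rho>. w x / bdist x powr \<alpha> \<le> A" if "y \<in> closure \<Omega>" for y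
  proof (cases "y \<in> \<Omega>")
    case True
    define \<rho> where "\<rho> = bdist y / 2"
    have \<rho>: "0 < \<rho>" using bdist_pos[OF True] by (simp add: \<rho>_def)
    have "w x / bdist x powr \<alpha> \<le> W / \<rho> powr \<alpha>" if x: "x \<in> \<Omega> \<inter> ball y \<rho>" for x
    proof (rule frac_le)
      have "\<rho> \<le> bdist x" using bdist_triangle[of y x] x by (auto simp: \<rho>_def)
      then show "\<rho> powr \<alpha> \<le> bdist x powr \<alpha>" using \<rho> \<alpha> by (intro powr_mono2) auto
    qed (use W W\<Omega> x \<rho> in auto)
    then show ?thesis using \<rho> by blast
  next
    case False
    then have y: "y \<in> frontier \<Omega>" using that closure_domain_cases by blast
    obtain \<rho>0 K h \<zeta> where chart0: "boundary_chart \<Omega> y \<rho>0 K h \<zeta>"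
      using boundary_chart_exists[OF C2_domain open_domain y] .
    have K: "1 \<le> K" and \<rho>0: "0 < \<rho>0" using chart0 by (simp_all add: boundary_chart_def)
    define C1 where "C1 = 2 * K * (real CARD('n) * L) + \<Gamma> * K + 1"
    have C1: "0 < C1" unfolding C1_def using K ell \<Gamma> by (intro add_nonneg_pos add_nonneg_nonneg) auto
    obtain \<tau>1 where \<tau>1: "0 < \<tau>1" "\<And>t. 0 < t \<Longrightarrow> t < \<tau>1 \<Longrightarrow> G1 t \<le> l / (8 * C1) * G2 t"
      using ratio[of "l / (8 * C1)"] C1 ell by auto
    define \<tau> where "\<tau> = min \<tau>0 \<tau>1"
    have \<tau>: "0 < \<tau>" "\<tau> \<le> \<tau>0" "\<tau> \<le> \<tau>1" using \<tau>0 \<tau>1 by (simp_all add: \<tau>_def)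
    define \<rho> where "\<rho> = min \<rho>0 (\<tau> / K)"
    have \<rho>: "0 < \<rho>" "\<rho> \<le> \<rho>0" "K * \<rho> \<le> \<tau>" using \<rho>0 \<tau> K by (auto simp: \<rho>_def min_def field_simps)
    have chart: "boundary_chart \<Omega> y \<rho> K h \<zeta>" using boundary_chart_mono[OF chart0 \<rho>(1,2)] .
    have hcont: "continuous_on (ball y \<rho>) h"
      and in\<Omega>: "\<And>x. x \<in> ball y \<rho> \<Longrightarrow> x \<in> \<Omega> \<longleftrightarrow> 0 < h x"
      and \<zeta>: "\<And>x. x \<in> ball y \<rho> \<Longrightarrow> 1 \<le> norm (\<zeta> x) \<and> norm (\<zeta> x) \<le> K"
      and hd: "\<And>x. x \<in> ball y \<rho> \<Longrightarrow> x \<in> \<Omega> \<Longrightarrow> bdist x \<le> h x \<and> h x \<le> K * bdist x"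
      and tay: "\<And>x x1. x \<in> ball y \<rho> \<Longrightarrow> x1 \<in> ball y \<rho> \<Longrightarrow>
            \<bar>h x - h x1 - \<zeta> x1 \<bullet> (x - x1)\<bar> \<le> K * (norm (x - x1))\<^sup>2"
      using chart by (simp_all add: boundary_chart_def)
    have hsmall: "h x < \<tau>" if "x \<in> ball y \<rho>" for x
    proof (cases "x \<in> \<Omega>")
      case True
      have "bdist x < \<rho>" using infdist_le[of y "- \<Omega>" x] False that by (auto simp: dist_commute)
      then have "K * bdist x < K * \<rho>" using K by simp
      then show ?thesis using hd[OF that True] \<rho>(3) by simp
    qed (use in\<Omega>[OF that] \<tau> in auto)
    define \<sigma> where "\<sigma> = \<rho> / 2"
    have \<sigma>: "0 < \<sigma>" using \<rho> by (simp add: \<sigma>_def)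
    define B where "B = W / \<sigma>\<^sup>2"
    have B: "0 < B" using W \<sigma> by (simp add: B_def)
    define C2 where "C2 = (real CARD('n) * L) * (1 + 2 * B) + \<Gamma> * (2 * B * \<sigma>)"
    have C2: "0 \<le> C2" unfolding C2_def using ell \<Gamma> B \<sigma> by (intro add_nonneg_nonneg mult_nonneg_nonneg) auto
    define C3 where "C3 = k * c powr (- p) * K powr b"
    have C3: "0 \<le> C3" using k by (simp add: C3_def)
    define A where "A = max 1 (8 * (C2 + C3 + 1) / (l * c'))"
    have A: "1 \<le> A" by (simp add: A_def)
    have "8 * (C2 + C3 + 1) / (l * c') * (l * c') \<le> A * (l * c')"
      using ell c' by (intro mult_right_mono) (auto simp: A_def)
    then have Abig: "C2 + C3 < A * l * c' / 8" using ell c' by (simp add: mult_ac)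
    have "w x0 / bdist x0 powr \<alpha> \<le> A * c2 * K powr \<alpha>" if "x0 \<in> \<Omega> \<inter> ball y \<sigma>" for x0
    proof -
      have x0: "x0 \<in> \<Omega>" "x0 \<in> ball y \<sigma>" using that by auto
      have sub: "cball x0 \<sigma> \<subseteq> ball y \<rho>"
      proof
        fix x assume "x \<in> cball x0 \<sigma>"
        then show "x \<in> ball y \<rho>" using x0(2) dist_triangle[of y x x0] by (simp add: \<sigma>_def)
      qed
      have x0b: "x0 \<in> ball y \<rho>" using x0(2) \<rho> by (simp add: \<sigma>_def)
      have h0: "0 < h x0" using in\<Omega>[OF x0b] x0 by simp
      have "w x0 \<le> A * G (h x0)"
      proof (rule ccontr)
        assume contra: "\<not> ?thesis"
        \<comment> \<open>the maximum makes the barrier meaningful and nonnegative up to the boundary, where \<open>h\<close> vanishes or is negative\<close>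
        define \<Psi> where "\<Psi> = (\<lambda>x. A * G (max 0 (h x)) + B * (norm (x - x0))\<^sup>2)"
        define S where "S = closure \<Omega> \<inter> cball x0 \<sigma>"
        have Sb: "x \<in> ball y \<rho>" if "x \<in> S" for x using that sub by (auto simp: S_def)
        have GS: "0 \<le> G (max 0 (h x))" if "x \<in> S" for x
        proof -
          have "0 \<le> c * max 0 (h x) powr \<alpha>" using c by simp
          also have "\<dots> \<le> G (max 0 (h x))" using hsmall[OF Sb[OF that]] \<tau> G[of "max 0 (h x)"] by auto
          finally show ?thesis .
        qed
        have "continuous_on S (\<lambda>x. G (max 0 (h x)))"
        proof (rule continuous_on_compose2[OF Gcont])
          show "continuous_on S (\<lambda>x. max 0 (h x))"
            using Sb by (intro continuous_intros continuous_on_subset[OF hcont]) auto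
          show "(\<lambda>x. max 0 (h x)) ` S \<subseteq> {0..\<tau>0}" using hsmall[OF Sb] \<tau> \<tau>0 by fastforce
        qed
        then have "continuous_on S (\<lambda>x. w x - \<Psi> x)" unfolding \<Psi>_def
          by (intro continuous_intros continuous_on_subset[OF cont]) (auto simp: S_def)
        moreover have "compact S" unfolding S_def using compact_closure_domain by (intro compact_Int) auto
        moreover have x0S: "x0 \<in> S" using x0 closure_subset \<sigma> by (auto simp: S_def)
        ultimately obtain x1 where x1: "x1 \<in> S" and max: "\<And>x. x \<in> S \<Longrightarrow> w x - \<Psi> x \<le> w x1 - \<Psi> x1"
          using continuous_attains_sup[of S "\<lambda>x. w x - \<Psi> x"] by blast
        have above: "\<Psi> x1 < w x1" using max[OF x0S] contra h0 by (simp add: \<Psi>_def)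
        have x1b: "x1 \<in> ball y \<rho>" by (rule Sb[OF x1])
        have \<Psi>1: "B * (norm (x1 - x0))\<^sup>2 \<le> \<Psi> x1" using GS[OF x1] A by (simp add: \<Psi>_def)
        have "0 \<le> B * (norm (x1 - x0))\<^sup>2" using B by simp
        \<comment> \<open>the maximum is not on the boundary of the domain, as \<open>w\<close> vanishes there\<close>
        then have "w x1 \<noteq> 0" using above \<Psi>1 by linarith
        then have x1\<Omega>: "x1 \<in> \<Omega>" using x1 bv closure_domain_cases by (auto simp: S_def)
        have w1: "0 < w x1" by (rule pos[OF x1\<Omega>])
        have n1: "norm (x1 - x0) < \<sigma>"
        proof (rule ccontr)
          assume "\<not> ?thesis"
          then have "norm (x1 - x0) = \<sigma>" using x1 by (simp add: S_def dist_norm norm_minus_commute)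
          then have "B * (norm (x1 - x0))\<^sup>2 = W" using \<sigma> by (simp add: B_def)
          then show False using above \<Psi>1 W\<Omega>[OF x1\<Omega>] by simp
        qed
        define s where "s = h x1"
        have s: "0 < s" "s < \<tau>0" "s < \<tau>1" "s \<le> 1"
          using in\<Omega>[OF x1b] x1\<Omega> hsmall[OF x1b] \<tau> \<tau>0 by (auto simp: s_def)
        define g1 where "g1 = G1 s"
        define g2 where "g2 = G2 s"
        have g1: "0 \<le> g1" using G1 s by (simp add: g1_def)
        have g2: "c' * s powr (- m) \<le> g2" using G2 s by (simp add: g2_def)
        have g2pos: "0 < g2" using g2 c' s by (smt (verit) mult_pos_pos powr_gt_zero)
        \<comment> \<open>half of the concavity is given up to get a majorant without remainder\<close>
        obtain d where d: "0 < d" "\<And>z. \<bar>z\<bar> < d \<Longrightarrow> G (s + z) \<le> G s + g1 * z - (g2 / 2) / 2 * z\<^sup>2"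
        proof (rule quadratic_majorant[of "min s (\<tau>0 - s)" s G G1 "- g2" "g2 / 2"])
          show "0 < min s (\<tau>0 - s)" using s by simp
          show "(G has_real_derivative G1 t) (at t)" if "\<bar>t - s\<bar> < min s (\<tau>0 - s)" for t
            using G'[of t] that by (auto simp: abs_less_iff)
          show "(G1 has_real_derivative - g2) (at s)" using G''[of s] s by (simp add: g2_def)
          show "- g2 < - (g2 / 2)" using g2pos by simp
        qed (use that g1_def in blast)
        \<comment> \<open>the error \<open>1 / (2 * A)\<close> becomes a constant after multiplication by \<open>A\<close>, hence does not compete with the choice of \<open>A\<close>\<close>
        obtain e where e: "0 < e" "\<And>v \<eta>. norm v < e \<Longrightarrow> \<bar>\<eta> - \<zeta> x1 \<bullet> v\<bar> \<le> K * (norm v)\<^sup>2 \<Longrightarrow>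
             G (s + \<eta>) \<le> G s + g1 * (\<zeta> x1 \<bullet> v) + (g1 * K + 1 / (2 * A)) * (norm v)\<^sup>2
               - (g2 / 2) / 4 * (\<zeta> x1 \<bullet> v)\<^sup>2"
          using parabola_through_chart[of d G s g1 "g2 / 2" "1 / (2 * A)" K "\<zeta> x1"] d g1 g2pos A K \<zeta>[OF x1b]
          by auto
        define qa where "qa = 2 * A * g1 * K + 1 + 2 * B"
        define qb where "qb = A * g2 / 4"
        define \<xi> where "\<xi> = (A * g1) *\<^sub>R \<zeta> x1 + (2 * B) *\<^sub>R (x1 - x0)"
        have low: "F (mat qa - qb *\<^sub>R outer (\<zeta> x1)) \<xi> (w x1) x1 \<le> f x1"
        proof (rule visc_sub_jet[OF vs x1\<Omega> sym_shifted_outer])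
          show "0 < min e (\<sigma> - norm (x1 - x0))" using n1 e by simp
          fix x assume x: "x \<in> \<Omega>" "dist x1 x < min e (\<sigma> - norm (x1 - x0))"
          then have xS: "x \<in> S"
            using dist_triangle[of x0 x x1] closure_subset by (auto simp: S_def dist_norm norm_minus_commute)
          have hx: "0 < h x" using in\<Omega>[OF Sb[OF xS]] x by simp
          define v where "v = x - x1"
          have "norm v < e" using x by (simp add: v_def dist_norm norm_minus_commute)
          moreover have "\<bar>(h x - s) - \<zeta> x1 \<bullet> v\<bar> \<le> K * (norm v)\<^sup>2"
            using tay[OF Sb[OF xS] x1b] by (simp add: v_def s_def)
          ultimately have "G (s + (h x - s)) \<le> G s + g1 * (\<zeta> x1 \<bullet> v) + (g1 * K + 1 / (2 * A)) * (norm v)\<^sup>2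
               - (g2 / 2) / 4 * (\<zeta> x1 \<bullet> v)\<^sup>2" by (rule e(2))
          then have "A * G (h x) \<le> A * (G s + g1 * (\<zeta> x1 \<bullet> v) + (g1 * K + 1 / (2 * A)) * (norm v)\<^sup>2
               - (g2 / 2) / 4 * (\<zeta> x1 \<bullet> v)\<^sup>2)" using A by (intro mult_left_mono) auto
          also have "\<dots> = A * G s + A * g1 * (\<zeta> x1 \<bullet> v) + (A * g1 * K + 1 / 2) * (norm v)\<^sup>2
               - qb / 2 * (\<zeta> x1 \<bullet> v)\<^sup>2" using A by (simp add: qb_def field_simps)
          finally have "A * G (h x) \<le> \<dots>" .
          moreover have "w x \<le> w x1 + (\<Psi> x - \<Psi> x1)" using max[OF xS] by simp
          moreover have "\<Psi> x - \<Psi> x1 = A * G (h x) - A * G s + B * (2 * ((x1 - x0) \<bullet> v) + (norm v)\<^sup>2)"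
            unfolding \<Psi>_def norm_diff_sq_expand[of x x0 x1] using hx s
            by (simp add: ring_distribs s_def v_def)
          moreover have "\<xi> \<bullet> v = A * g1 * (\<zeta> x1 \<bullet> v) + B * (2 * ((x1 - x0) \<bullet> v))"
            unfolding \<xi>_def inner_add_left by simp
          moreover have "v \<bullet> ((mat qa - qb *\<^sub>R outer (\<zeta> x1)) *v v) / 2
              = (A * g1 * K + 1 / 2) * (norm v)\<^sup>2 + B * (norm v)\<^sup>2 - qb / 2 * (\<zeta> x1 \<bullet> v)\<^sup>2"
            unfolding form_shifted_outer power2_norm_eq_inner by (simp add: qa_def field_simps)
          ultimately show "w x \<le> w x1 + \<xi> \<bullet> (x - x1)
              + (x - x1) \<bullet> ((mat qa - qb *\<^sub>R outer (\<zeta> x1)) *v (x - x1)) / 2"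
            unfolding v_def[symmetric] ring_distribs by linarith
        qed
        have "qa \<ge> 0" "qb \<ge> 0" using A g1 K B g2pos by (auto simp: qa_def qb_def)
        from F_shifted_outer_ge[OF x1\<Omega> this, of "w x1" "\<zeta> x1" \<xi>] w1 low
        have 1: "qb * l * (\<zeta> x1 \<bullet> \<zeta> x1) - qa * (real CARD('n) * L) - \<Gamma> * norm \<xi> \<le> f x1" by simp
        have "1 \<le> \<zeta> x1 \<bullet> \<zeta> x1" using \<zeta>[OF x1b] by (simp add: dot_square_norm)
        then have "qb * l * 1 \<le> qb * l * (\<zeta> x1 \<bullet> \<zeta> x1)" using \<open>0 \<le> qb\<close> ell by (intro mult_left_mono) auto
        moreover have "\<Gamma> * norm \<xi> \<le> \<Gamma> * (A * g1 * K + 2 * B * \<sigma>)"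
        proof -
          have "norm \<xi> \<le> A * g1 * norm (\<zeta> x1) + 2 * B * norm (x1 - x0)"
            unfolding \<xi>_def by (rule order_trans[OF norm_triangle_ineq]) (use A g1 B in simp)
          also have "\<dots> \<le> A * g1 * K + 2 * B * \<sigma>"
            using A g1 B \<zeta>[OF x1b] n1 by (intro add_mono mult_left_mono) auto
          finally show ?thesis using \<Gamma> by (intro mult_left_mono) auto
        qed
        ultimately have "qb * l - qa * (real CARD('n) * L) - \<Gamma> * (A * g1 * K + 2 * B * \<sigma>) \<le> f x1" using 1 by linarith
        moreover have "qb * l - qa * (real CARD('n) * L) - \<Gamma> * (A * g1 * K + 2 * B * \<sigma>)
            = A * (g2 * l / 4 - g1 * (C1 - 1)) - C2"
          by (simp add: qa_def qb_def C1_def C2_def field_simps)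
        moreover have "g1 * (C1 - 1) \<le> g2 * l / 8"
        proof -
          have "g1 * (C1 - 1) \<le> g1 * C1" using g1 by (intro mult_left_mono) auto
          also have "\<dots> \<le> l / (8 * C1) * g2 * C1"
            using \<tau>1(2)[of s] s C1 by (intro mult_right_mono) (auto simp: g1_def g2_def)
          finally show ?thesis using C1 by (simp add: field_simps)
        qed
        ultimately have "A * (g2 * l / 4 - g2 * l / 8) - C2 \<le> f x1"
          using A by (smt (verit) mult_left_mono)
        then have "A * l / 8 * g2 - C2 \<le> f x1" by (simp add: field_simps)
        moreover have "A * l / 8 * (c' * s powr (- m)) \<le> A * l / 8 * g2"
          using A ell g2 by (intro mult_left_mono) auto
        ultimately have lower: "A * l * c' / 8 * s powr (- m) - C2 \<le> f x1" by (simp add: mult_ac)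
        have "f x1 \<le> k * w x1 powr (- p) * bdist x1 powr (- b)" by (rule f[OF x1\<Omega>])
        also have "\<dots> \<le> k * (c * s powr \<alpha>) powr (- p) * (s / K) powr (- b)"
        proof (intro mult_mono mult_left_mono)
          have "c * s powr \<alpha> \<le> G s" using G[of s] s by simp
          also have "\<dots> \<le> A * G s" using A GS[OF x1] s by (simp add: s_def mult_le_cancel_right1)
          also have "\<dots> \<le> \<Psi> x1" using B s by (simp add: \<Psi>_def s_def)
          finally have "c * s powr \<alpha> \<le> w x1" using above by simp
          then show "w x1 powr (- p) \<le> (c * s powr \<alpha>) powr (- p)"
            using c s p by (intro powr_mono2') auto
          have "s / K \<le> bdist x1" using hd[OF x1b x1\<Omega>] K by (simp add: s_def field_simps)
          then show "bdist x1 powr (- b) \<le> (s / K) powr (- b)"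
            using s K b by (intro powr_mono2') auto
        qed (use k in auto)
        also have "\<dots> = C3 * s powr (- (\<alpha> * p + b))"
          using c s K by (simp add: C3_def powr_mult powr_divide powr_powr powr_minus powr_diff powr_add field_simps)
        also have "\<dots> \<le> C3 * s powr (- m)" using s \<alpha> C3 by (intro mult_left_mono powr_mono') auto
        finally have "A * l * c' / 8 * s powr (- m) \<le> C2 + C3 * s powr (- m)" using lower by simp
        moreover have "C2 \<le> C2 * s powr (- m)"
        proof -
          have "0 \<le> m" using \<alpha> p b by (smt (verit) mult_nonneg_nonneg)
          then have "s powr 0 \<le> s powr (- m)" using s by (intro powr_mono') auto
          then show ?thesis using C2 s by (simp add: mult_le_cancel_left1)
        qed
        ultimately have "A * l * c' / 8 * s powr (- m) \<le> (C2 + C3) * s powr (- m)" by (simp add: ring_distribs)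
        then show False using Abig s by (simp add: mult_le_cancel_right)
      qed
      also have "\<dots> \<le> A * (c2 * (K * bdist x0) powr \<alpha>)"
      proof (rule mult_left_mono)
        have "G (h x0) \<le> c2 * h x0 powr \<alpha>" using G[of "h x0"] h0 hsmall[OF x0b] \<tau> by simp
        also have "\<dots> \<le> c2 * (K * bdist x0) powr \<alpha>"
          using hd[OF x0b x0(1)] h0 \<alpha> \<open>0 \<le> c2\<close> by (intro mult_left_mono powr_mono2) auto
        finally show "G (h x0) \<le> c2 * (K * bdist x0) powr \<alpha>" .
      qed (use A in simp)
      also have "\<dots> = A * c2 * K powr \<alpha> * bdist x0 powr \<alpha>"
        using K bdist_pos[OF x0(1)] by (simp add: powr_mult)
      finally show ?thesis using bdist_pos[OF x0(1)] by (simp add: divide_le_eq)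
    qed
    then show ?thesis using \<sigma> by blast
  qed
  then obtain A where A: "A > 0" "\<And>x. x \<in> \<Omega> \<Longrightarrow> w x / bdist x powr \<alpha> \<le> A"
    using locally_bounded_above_on_compact[OF compact_closure_domain, of \<Omega> "\<lambda>x. w x / bdist x powr \<alpha>"] closure_subset
    by metis
  show thesis
  proof
    show "0 < A" by (rule A(1))
    fix x assume "x \<in> \<Omega>"
    then show "w x \<le> A * bdist x powr \<alpha>" using A(2)[of x] bdist_pos[of x] by (simp add: divide_le_eq)
  qed
qed

text \<open>
  The profile is \<open>t powr \<alpha>\<close>, whose second derivative has order \<open>t powr (\<alpha> - 2)\<close>.
\<close>

lemma subsolution_power_upper_bound:
  assumes vs: "visc_sub \<Omega> F w f" "continuous_on (closure \<Omega>) w"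
    "\<And>x. x \<in> \<Omega> \<Longrightarrow> 0 < w x" "\<And>x. x \<in> frontier \<Omega> \<Longrightarrow> w x = 0"
    "\<And>x. x \<in> \<Omega> \<Longrightarrow> f x \<le> k * w x powr (- p) * bdist x powr (- b)"
    and k: "0 < k" "0 \<le> p" "0 \<le> b" and \<alpha>: "0 < \<alpha>" "\<alpha> < 1" "\<alpha> * (1 + p) + b \<le> 2"
  obtains A where "0 < A" "\<And>x. x \<in> \<Omega> \<Longrightarrow> w x \<le> A * bdist x powr \<alpha>"
proof (rule subsolution_upper_bound_by_profile[OF vs k \<alpha>(1), where m = "2 - \<alpha>" and ?\<tau>0.0 = 1
      and c = 1 and ?c2.0 = 1 and c' = "\<alpha> * (1 - \<alpha>)" and G = "\<lambda>t. t powr \<alpha>"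
      and ?G1.0 = "\<lambda>t. \<alpha> * t powr (\<alpha> - 1)" and ?G2.0 = "\<lambda>t. \<alpha> * (1 - \<alpha>) * t powr (\<alpha> - 2)"])
  show "\<alpha> * p + b \<le> 2 - \<alpha>" using \<alpha>(3) by (simp add: ring_distribs)
  show "continuous_on {0..1} (\<lambda>t::real. t powr \<alpha>)"
    using \<alpha> by (intro continuous_on_powr' continuous_intros) auto
  fix t :: real assume t: "0 < t"
  show "((\<lambda>t. t powr \<alpha>) has_real_derivative \<alpha> * t powr (\<alpha> - 1)) (at t)"
    using t by (rule has_real_derivative_powr)
  show "((\<lambda>t. \<alpha> * t powr (\<alpha> - 1)) has_real_derivative - (\<alpha> * (1 - \<alpha>) * t powr (\<alpha> - 2))) (at t)"
    using DERIV_cmult[OF has_real_derivative_powr[OF t, of "\<alpha> - 1"], of \<alpha>] by (simp add: algebra_simps)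
next
  fix \<epsilon> :: real assume \<epsilon>: "0 < \<epsilon>"
  show "\<exists>\<tau>>0. \<forall>t. 0 < t \<and> t < \<tau> \<longrightarrow> \<alpha> * t powr (\<alpha> - 1) \<le> \<epsilon> * (\<alpha> * (1 - \<alpha>) * t powr (\<alpha> - 2))"
  proof (intro exI[of _ "\<epsilon> * (1 - \<alpha>)"] conjI allI impI)
    fix t assume t: "0 < t \<and> t < \<epsilon> * (1 - \<alpha>)"
    have "\<alpha> * t powr (\<alpha> - 1) = \<alpha> * t powr (\<alpha> - 2) * t"
      using t by (simp add: powr_diff power2_eq_square)
    also have "\<dots> \<le> \<alpha> * t powr (\<alpha> - 2) * (\<epsilon> * (1 - \<alpha>))" using t \<alpha> by (intro mult_left_mono) auto
    finally show "\<alpha> * t powr (\<alpha> - 1) \<le> \<epsilon> * (\<alpha> * (1 - \<alpha>) * t powr (\<alpha> - 2))" by (simp add: mult_ac)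
  qed (use \<epsilon> \<alpha> in auto)
qed (use \<alpha> that in auto)

text \<open>
  The profile \<open>t\<close> itself is not concave enough. Subtracting a multiple of \<open>t powr (1 + \<kappa>)\<close> keeps the
  linear size near 0 and produces the second derivative \<open>- c' t powr (\<kappa> - 1)\<close>, which is integrable but
  dominates a right-hand side of order \<open>t powr (- p - b)\<close> when \<open>\<kappa> \<le> 1 - p - b\<close>.
\<close>

lemma subsolution_linear_upper_bound:
  assumes vs: "visc_sub \<Omega> F w f" "continuous_on (closure \<Omega>) w"
    "\<And>x. x \<in> \<Omega> \<Longrightarrow> 0 < w x" "\<And>x. x \<in> frontier \<Omega> \<Longrightarrow> w x = 0"
    "\<And>x. x \<in> \<Omega> \<Longrightarrow> f x \<le> k * w x powr (- p) * bdist x powr (- b)"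
    and k: "0 < k" "0 \<le> p" "0 \<le> b" and pb: "p + b < 1"
  obtains A where "0 < A" "\<And>x. x \<in> \<Omega> \<Longrightarrow> w x \<le> A * bdist x powr 1"
proof -
  define \<kappa> where "\<kappa> = (1 - p - b) / 2"
  have \<kappa>: "0 < \<kappa>" "\<kappa> \<le> 1 / 2" "p + b \<le> 1 - \<kappa>" using pb k by (auto simp: \<kappa>_def field_simps)
  define c' where "c' = (1 + \<kappa>) * \<kappa> / 2"
  have c': "0 < c'" using \<kappa> by (simp add: c'_def)
  have small: "t powr r \<le> 1" if "0 \<le> t" "t \<le> 1" "0 \<le> r" for t r :: real
    using powr_mono2[of r t 1] that by simp
  show thesis
  proof (rule subsolution_upper_bound_by_profile[OF vs k, where \<alpha> = 1 and m = "1 - \<kappa>" and ?\<tau>0.0 = 1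
      and c = "1/2" and ?c2.0 = 1 and c' = c' and G = "\<lambda>t. t - t powr (1 + \<kappa>) / 2"
      and ?G1.0 = "\<lambda>t. 1 - (1 + \<kappa>) / 2 * t powr \<kappa>" and ?G2.0 = "\<lambda>t. c' * t powr (\<kappa> - 1)"])
    show "1 * p + b \<le> 1 - \<kappa>" using \<kappa> by simp
    show "continuous_on {0..1} (\<lambda>t. t - t powr (1 + \<kappa>) / 2)"
      using \<kappa> by (intro continuous_on_powr' continuous_intros) auto
    fix t :: real
    assume t: "0 \<le> t" "t \<le> 1"
    have "t powr (1 + \<kappa>) = t * t powr \<kappa>" using t by (cases "t = 0") (auto simp: powr_add)
    also have "\<dots> \<le> t" using small[OF t, of \<kappa>] \<kappa> t by (simp add: mult_left_le)
    finally show "1/2 * t powr 1 \<le> t - t powr (1 + \<kappa>) / 2 \<and> t - t powr (1 + \<kappa>) / 2 \<le> 1 * t powr 1"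
      using t by simp
  next
    fix t :: real assume t: "0 < t" "t < 1"
    show "((\<lambda>t. t - t powr (1 + \<kappa>) / 2) has_real_derivative 1 - (1 + \<kappa>) / 2 * t powr \<kappa>) (at t)"
      using DERIV_diff[OF DERIV_ident DERIV_cdivide[OF has_real_derivative_powr[OF t(1), of "1 + \<kappa>"], of 2]] by simp
    show "((\<lambda>t. 1 - (1 + \<kappa>) / 2 * t powr \<kappa>) has_real_derivative - (c' * t powr (\<kappa> - 1))) (at t)"
      using DERIV_diff[OF DERIV_const DERIV_cmult[OF has_real_derivative_powr[OF t(1), of \<kappa>], of "(1 + \<kappa>) / 2"], of 1]
      by (simp add: c'_def mult.assoc)
    have "(1 + \<kappa>) / 2 * t powr \<kappa> \<le> 1 * 1" using t \<kappa> small[of t \<kappa>] by (intro mult_mono) auto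
    then show "0 \<le> 1 - (1 + \<kappa>) / 2 * t powr \<kappa>" by simp
    show "c' * t powr (- (1 - \<kappa>)) \<le> c' * t powr (\<kappa> - 1)" by simp
  next
    fix \<epsilon> :: real assume \<epsilon>: "0 < \<epsilon>"
    show "\<exists>\<tau>>0. \<forall>t. 0 < t \<and> t < \<tau> \<longrightarrow> 1 - (1 + \<kappa>) / 2 * t powr \<kappa> \<le> \<epsilon> * (c' * t powr (\<kappa> - 1))"
    proof (intro exI[of _ "(\<epsilon> * c') powr (1 / (1 - \<kappa>))"] conjI allI impI)
      fix t assume t: "0 < t \<and> t < (\<epsilon> * c') powr (1 / (1 - \<kappa>))"
      have "t powr (1 - \<kappa>) \<le> ((\<epsilon> * c') powr (1 / (1 - \<kappa>))) powr (1 - \<kappa>)"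
        using t \<kappa> by (intro powr_mono2) auto
      also have "\<dots> = \<epsilon> * c'" using \<kappa> \<epsilon> c' by (simp add: powr_powr)
      finally have "t powr (1 - \<kappa>) * t powr (\<kappa> - 1) \<le> \<epsilon> * c' * t powr (\<kappa> - 1)"
        by (rule mult_right_mono) simp
      then have "1 \<le> \<epsilon> * (c' * t powr (\<kappa> - 1))" using t by (simp add: powr_add[symmetric] mult_ac)
      moreover have "0 \<le> (1 + \<kappa>) / 2 * t powr \<kappa>" using \<kappa> by simp
      ultimately show "1 - (1 + \<kappa>) / 2 * t powr \<kappa> \<le> \<epsilon> * (c' * t powr (\<kappa> - 1))" by linarith
    qed (use \<epsilon> c' in simp)
  qed (use c' that in auto)
qed

section \<open>Nonexistence of positive solutions\<close>

text \<open>
  In each case the bounds lead to an equation with a right-hand side of at least inverse square order.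
  \<^item> In the first alternative with \<open>p + q > 1\<close>, the Hopf bound for \<open>v\<close> gives
  \<open>u \<le> A d powr ((2 - q) / (1 + p))\<close>, where \<open>d\<close> is the distance to the boundary, and this makes
  \<open>u powr (- r)\<close> of inverse square order.
  \<^item> In the first alternative with \<open>p + q \<le> 1\<close>, so that \<open>r \<ge> 2\<close>, a linear bound for \<open>u\<close> is needed when
  \<open>r = 2\<close>. When \<open>p + q = 1\<close>, the Hopf bound for \<open>v\<close> is not enough for that, as it leaves a logarithm.
  Instead \<open>u \<le> A d powr (1 - \<eta>)\<close> makes \<open>v\<close> as large as \<open>d powr (2 \<eta>)\<close>, and since \<open>p < 1\<close>, this
  makes the right-hand side of the first equation integrable enough for \<open>u \<le> A d\<close>.
  \<^item> In the second alternative \<open>v\<close> is bounded, hence \<open>u \<ge> c d powr (2 / (1 + p))\<close>. This bounds the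
  right-hand side of the second equation and so \<open>v\<close> from above by a power of \<open>d\<close>, and then
  \<open>v powr (- q)\<close> is of inverse square order in the first equation.
\<close>

lemma no_positive_solution:
  assumes u: "visc_sub \<Omega> F u f1" "visc_super \<Omega> F u f1" "continuous_on (closure \<Omega>) u"
      "\<And>x. x \<in> \<Omega> \<Longrightarrow> 0 < u x" "\<And>x. x \<in> frontier \<Omega> \<Longrightarrow> u x = 0"
    and v: "visc_sub \<Omega> F v f2" "visc_super \<Omega> F v f2" "continuous_on (closure \<Omega>) v"
      "\<And>x. x \<in> \<Omega> \<Longrightarrow> 0 < v x" "\<And>x. x \<in> frontier \<Omega> \<Longrightarrow> v x = 0"
    and f1: "\<And>x. x \<in> \<Omega> \<Longrightarrow> f1 x = u x powr (- p) * v x powr (- q)"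
    and f2: "\<And>x. x \<in> \<Omega> \<Longrightarrow> f2 x = u x powr (- r) * v x powr (- s)"
    and e: "p \<ge> 0" "s \<ge> 0" "q > 0" "r > 0"
    and cond: "r * min 1 ((2 - q) / (1 + p)) \<ge> 2 \<or>
       (p > max 1 (r - 1) \<and> 2 * r > (1 - s) * (1 + p) \<and> q * (1 + p - r) > (1 + p) * (1 + s))"
  shows False
proof -
  obtain W where W: "1 \<le> W" "\<And>x. x \<in> \<Omega> \<Longrightarrow> u x \<le> W"
    using continuous_bounded_above[OF u(3)] by metis
  obtain V where V: "1 \<le> V" "\<And>x. x \<in> \<Omega> \<Longrightarrow> v x \<le> V"
    using continuous_bounded_above[OF v(3)] by metis
  have Wp: "W powr (- a) \<le> u x powr (- a)" if "0 \<le> a" "x \<in> \<Omega>" for a x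
    using that W u(4) by (intro powr_mono2') auto
  have Vp: "V powr (- a) \<le> v x powr (- a)" if "0 \<le> a" "x \<in> \<Omega>" for a x
    using that V v(4) by (intro powr_mono2') auto
  \<comment> \<open>an upper bound on one component is a lower bound on the singular factor in the other equation\<close>
  have f2_ge: "A powr (- r) * v x powr (- s) * bdist x powr (- (\<alpha> * r)) \<le> f2 x"
    if "u x \<le> A * bdist x powr \<alpha>" "0 < A" "x \<in> \<Omega>" for A \<alpha> x
  proof -
    have "A powr (- r) * bdist x powr (- (\<alpha> * r)) * v x powr (- s) \<le> u x powr (- r) * v x powr (- s)"
      using that e u(4) bdist_pos by (intro mult_right_mono powr_neg_ge_of_upper) auto
    then show ?thesis using f2[OF that(3)] by (simp add: mult_ac)
  qed
  have f1_le: "f1 x \<le> c powr (- q) * u x powr (- p) * bdist x powr (- (\<alpha> * q))"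
    if "c * bdist x powr \<alpha> \<le> v x" "0 < c" "x \<in> \<Omega>" for c \<alpha> x
  proof -
    have "v x powr (- q) * u x powr (- p) \<le> c powr (- q) * bdist x powr (- (\<alpha> * q)) * u x powr (- p)"
      using that e bdist_pos by (intro mult_right_mono powr_neg_le_of_lower) auto
    then show ?thesis using f1[OF that(3)] by (simp add: mult_ac)
  qed
  have no_v: False if "\<And>x. x \<in> \<Omega> \<Longrightarrow> u x \<le> A * bdist x powr \<alpha>" "0 < A" "2 \<le> \<alpha> * r" for A \<alpha>
    using that e by (intro no_supersolution_inverse_square[OF v(2-5), of "A powr (- r)" s "\<alpha> * r"] f2_ge) auto
  from cond show False
  proof
    assume c1: "r * min 1 ((2 - q) / (1 + p)) \<ge> 2"
    obtain cv where cv: "0 < cv" "\<And>x. x \<in> \<Omega> \<Longrightarrow> cv * bdist x \<le> v x"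
    proof (rule supersolution_linear_lower_bound[OF v(2-5)])
      show "W powr (- r) * V powr (- s) \<le> f2 x" if "x \<in> \<Omega>" for x
        using f2[OF that] Wp[OF _ that] Vp[OF _ that] e by (auto intro!: mult_mono)
    qed (use W V that in auto)
    have f1_le_lin: "f1 x \<le> cv powr (- q) * u x powr (- p) * bdist x powr (- q)" if "x \<in> \<Omega>" for x
      using f1_le[of cv x 1] cv that bdist_pos[OF that] by simp
    show False
    proof (cases "p + q > 1")
      case True
      define \<alpha> where "\<alpha> = (2 - q) / (1 + p)"
      have "0 < r * min 1 \<alpha>" using c1 by (simp add: \<alpha>_def)
      then have "0 < min 1 \<alpha>" using e by (simp add: zero_less_mult_iff)
      then have \<alpha>: "0 < \<alpha>" "\<alpha> < 1" using True e by (auto simp: \<alpha>_def field_simps)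
      have "\<alpha> * (1 + p) + q \<le> 2" using e by (simp add: \<alpha>_def)
      then obtain A where "0 < A" "\<And>x. x \<in> \<Omega> \<Longrightarrow> u x \<le> A * bdist x powr \<alpha>"
        using subsolution_power_upper_bound[OF u(1,3-5) f1_le_lin _ e(1) _ \<alpha>] cv e by auto
      then show False using no_v[of A \<alpha>] c1 \<alpha> by (simp add: \<alpha>_def[symmetric] min_def mult.commute)
    next
      case False
      have "r * min 1 ((2 - q) / (1 + p)) \<le> r * 1" using e by (intro mult_left_mono) auto
      then have r: "2 \<le> r" using c1 by simp
      have p1: "p < 1" using False e by simp
      \<comment> \<open>any positive \<open>\<eta> < 1\<close> with \<open>p + 2 \<eta> q < 1\<close> would do\<close>
      define \<eta> where "\<eta> = min (1/2) ((1 - p) / (4 * q))"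
      have \<eta>: "0 < \<eta>" "\<eta> < 1" using p1 e by (auto simp: \<eta>_def)
      have "\<eta> * (4 * q) \<le> (1 - p) / (4 * q) * (4 * q)"
        unfolding \<eta>_def using e by (intro mult_right_mono) auto
      then have \<eta>q: "4 * (\<eta> * q) \<le> 1 - p" using e by simp
      have "(1 - \<eta>) * (1 + p) \<le> 1 * (1 + p)" using \<eta> e by (intro mult_right_mono) auto
      then have "(1 - \<eta>) * (1 + p) + q \<le> 2" using False by simp
      then obtain A where A: "0 < A" "\<And>x. x \<in> \<Omega> \<Longrightarrow> u x \<le> A * bdist x powr (1 - \<eta>)"
        using subsolution_power_upper_bound[OF u(1,3-5) f1_le_lin _ e(1), where \<alpha> = "1 - \<eta>"] cv e \<eta> by auto
      have "2 * (1 - \<eta>) \<le> (1 - \<eta>) * r" using mult_left_mono[OF r, of "1 - \<eta>"] \<eta> by simp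
      moreover have "2 * \<eta> \<le> 2 * \<eta> * (1 + s)" using \<eta> e by simp
      ultimately have "2 \<le> 2 * \<eta> * (1 + s) + (1 - \<eta>) * r" by simp
      then obtain c where c: "0 < c" "\<And>x. x \<in> \<Omega> \<Longrightarrow> c * bdist x powr (2 * \<eta>) \<le> v x"
        using supersolution_interior_lower_bound[OF v(2-4) f2_ge[OF A(2,1)], where \<alpha> = "2 * \<eta>"] A(1) e \<eta> by auto
      have "p + 2 * \<eta> * q < 1" using \<eta>q p1 by simp
      then obtain A' where "0 < A'" "\<And>x. x \<in> \<Omega> \<Longrightarrow> u x \<le> A' * bdist x powr 1"
        using subsolution_linear_upper_bound[OF u(1,3-5) f1_le[OF c(2,1)]] c(1) e \<eta> by auto
      then show False using no_v[of A' 1] r by simp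
    qed
  next
    assume c3: "p > max 1 (r - 1) \<and> 2 * r > (1 - s) * (1 + p) \<and> q * (1 + p - r) > (1 + p) * (1 + s)"
    have p: "p > 1" "r < 1 + p" using c3 by auto
    have f1_ge: "V powr (- q) * u x powr (- p) * bdist x powr (- 0) \<le> f1 x" if "x \<in> \<Omega>" for x
      using f1[OF that] mult_right_mono[OF Vp[OF _ that, of q], of "u x powr (- p)"] e bdist_pos[OF that]
      by (simp add: mult.commute)
    \<comment> \<open>the critical exponent of \<open>F = u powr (- p)\<close>, where the scaling estimate is just applicable\<close>
    have crit: "2 \<le> 2 / (1 + p) * (1 + p) + 0" using p by (simp add: field_simps)
    obtain c where c: "0 < c" "\<And>x. x \<in> \<Omega> \<Longrightarrow> c * bdist x powr (2 / (1 + p)) \<le> u x"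
      using supersolution_interior_lower_bound[OF u(2-4) f1_ge _ e(1) _ _ crit] V p by auto
    define b where "b = 2 / (1 + p) * r"
    have f2_le: "f2 x \<le> c powr (- r) * v x powr (- s) * bdist x powr (- b)" if "x \<in> \<Omega>" for x
    proof -
      have "u x powr (- r) * v x powr (- s) \<le> c powr (- r) * bdist x powr (- b) * v x powr (- s)"
        unfolding b_def using that e bdist_pos c by (intro mult_right_mono powr_neg_le_of_lower) auto
      then show ?thesis using f2[OF that] by (simp add: mult_ac)
    qed
    define \<alpha> where "\<alpha> = (2 - b) / (1 + s)"
    have b: "0 \<le> b" "b < 2" using p e by (auto simp: b_def field_simps)
    have "1 - s < b" using c3 p by (simp add: b_def field_simps)
    then have \<alpha>: "0 < \<alpha>" "\<alpha> < 1" "\<alpha> * (1 + s) + b \<le> 2" using b e by (auto simp: \<alpha>_def field_simps)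
    obtain A where A: "0 < A" "\<And>x. x \<in> \<Omega> \<Longrightarrow> v x \<le> A * bdist x powr \<alpha>"
      using subsolution_power_upper_bound[OF v(1,3-5) f2_le _ e(2) b(1) \<alpha>] c(1) by auto
    have "\<alpha> * q = 2 * (q * (1 + p - r)) / ((1 + p) * (1 + s))"
      using p e by (simp add: \<alpha>_def b_def field_simps)
    also have "\<dots> \<ge> 2" using c3 p e by (simp add: field_simps)
    finally have "2 \<le> \<alpha> * q" .
    show False
    proof (rule no_supersolution_inverse_square[OF u(2-5)])
      show "A powr (- q) * u x powr (- p) * bdist x powr (- (\<alpha> * q)) \<le> f1 x" if "x \<in> \<Omega>" for x
      proof -
        have "A powr (- q) * bdist x powr (- (\<alpha> * q)) * u x powr (- p) \<le> v x powr (- q) * u x powr (- p)"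
          using that e v(4) bdist_pos A by (intro mult_right_mono powr_neg_ge_of_upper) auto
        then show ?thesis using f1[OF that] by (simp add: mult_ac)
      qed
    qed (use A e \<open>2 \<le> \<alpha> * q\<close> in auto)
  qed
qed

end

theorem theorem4p1:
  fixes \<Omega> :: "(real^'n) set"
    and F :: "real^'n^'n \<Rightarrow> real^'n \<Rightarrow> real \<Rightarrow> real^'n \<Rightarrow> real"
    and l L \<Gamma> \<gamma> C \<theta> p q r s :: real
  assumes dom: "bounded_C2_domain \<Omega>"
    and constants: "0 < l" "l \<le> L" "\<Gamma> \<ge> 0" "\<gamma> \<ge> 0" "C > 0" "0 < \<theta>" "\<theta> \<le> 1"
    and homogeneous: "\<And>M \<xi> z x t. M \<in> sym_matrices \<Longrightarrow> x \<in> \<Omega> \<Longrightarrow> t \<ge> 0 \<Longrightarrow>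
          F (t *\<^sub>R M) (t *\<^sub>R \<xi>) (t * z) x = t * F M \<xi> z x"
    and hoelder: "\<And>M \<xi> z x y. M \<in> sym_matrices \<Longrightarrow> x \<in> \<Omega> \<Longrightarrow> y \<in> \<Omega> \<Longrightarrow>
          \<bar>F M \<xi> z x - F M \<xi> z y\<bar> \<le> C * norm (x - y) powr \<theta> * (1 + norm M + norm \<xi> + \<bar>z\<bar>)"
    and convex: "\<And>x. x \<in> \<Omega> \<Longrightarrow>
          convex_on (sym_matrices \<times> UNIV \<times> UNIV) (\<lambda>(M, \<xi>, z). F M \<xi> z x)"
    and elliptic_lower: "\<And>M M' \<xi> \<xi>' z z' x. M \<in> sym_matrices \<Longrightarrow> M' \<in> sym_matrices \<Longrightarrow> x \<in> \<Omega> \<Longrightarrow>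
          pucci_minus l L (M - M') - \<Gamma> * norm (\<xi> - \<xi>') - \<gamma> * max (z' - z) 0
            \<le> F M \<xi> z x - F M' \<xi>' z' x"
    and elliptic_upper: "\<And>M M' \<xi> \<xi>' z z' x. M \<in> sym_matrices \<Longrightarrow> M' \<in> sym_matrices \<Longrightarrow> x \<in> \<Omega> \<Longrightarrow>
          F M \<xi> z x - F M' \<xi>' z' x
            \<le> pucci_plus l L (M - M') + \<Gamma> * norm (\<xi> - \<xi>') + \<gamma> * max (- (z' - z)) 0"
    and exponents: "p \<ge> 0" "s \<ge> 0" "q > 0" "r > 0"
    and cond:
      "r * min 1 ((2 - q) / (1 + p)) \<ge> 2 \<or>
       q * min 1 ((2 - r) / (1 + s)) \<ge> 2 \<or>
       (p > max 1 (r - 1) \<and> 2 * r > (1 - s) * (1 + p) \<and> q * (1 + p - r) > (1 + p) * (1 + s)) \<or>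
       (s > max 1 (q - 1) \<and> 2 * q > (1 - p) * (1 + s) \<and> r * (1 + s - q) > (1 + p) * (1 + s))"
  shows "\<not> (\<exists>u v. (\<forall>x\<in>\<Omega>. u x > 0 \<and> v x > 0) \<and>
           system_solution \<Omega> F
             (\<lambda>a b. a powr (- p) * b powr (- q)) (\<lambda>a b. a powr (- r) * b powr (- s))
             (\<lambda>_. 0) (\<lambda>_. 0) u v)"
proof
  interpret elliptic_dirichlet \<Omega> F l L \<Gamma> \<gamma>
  proof
    have "(0 :: real^'n^'n) \<in> sym_matrices" by (auto simp: sym_matrices_def transpose_def vec_eq_iff)
    then show "F 0 0 0 x = 0" if "x \<in> \<Omega>" for x using homogeneous[of 0 x 0 0 0] that by simp
  qed (fact dom constants elliptic_lower elliptic_upper)+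
  assume "\<exists>u v. (\<forall>x\<in>\<Omega>. u x > 0 \<and> v x > 0) \<and>
           system_solution \<Omega> F
             (\<lambda>a b. a powr (- p) * b powr (- q)) (\<lambda>a b. a powr (- r) * b powr (- s))
             (\<lambda>_. 0) (\<lambda>_. 0) u v"
  then obtain u v where pos: "\<And>x. x \<in> \<Omega> \<Longrightarrow> 0 < u x" "\<And>x. x \<in> \<Omega> \<Longrightarrow> 0 < v x"
    and sol: "system_solution \<Omega> F
             (\<lambda>a b. a powr (- p) * b powr (- q)) (\<lambda>a b. a powr (- r) * b powr (- s))
             (\<lambda>_. 0) (\<lambda>_. 0) u v" by blast
  define f1 where "f1 = (\<lambda>x. u x powr (- p) * v x powr (- q))"
  define f2 where "f2 = (\<lambda>x. u x powr (- r) * v x powr (- s))"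
  have u: "visc_sub \<Omega> F u f1" "visc_super \<Omega> F u f1" "continuous_on (closure \<Omega>) u"
      "\<And>x. x \<in> \<Omega> \<Longrightarrow> 0 < u x" "\<And>x. x \<in> frontier \<Omega> \<Longrightarrow> u x = 0"
    and v: "visc_sub \<Omega> F v f2" "visc_super \<Omega> F v f2" "continuous_on (closure \<Omega>) v"
      "\<And>x. x \<in> \<Omega> \<Longrightarrow> 0 < v x" "\<And>x. x \<in> frontier \<Omega> \<Longrightarrow> v x = 0"
    using sol pos
    by (auto simp: system_solution_def system_subsolution_def system_supersolution_def f1_def f2_def)
  from cond consider
      "r * min 1 ((2 - q) / (1 + p)) \<ge> 2 \<or>
       (p > max 1 (r - 1) \<and> 2 * r > (1 - s) * (1 + p) \<and> q * (1 + p - r) > (1 + p) * (1 + s))"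
    | "q * min 1 ((2 - r) / (1 + s)) \<ge> 2 \<or>
       (s > max 1 (q - 1) \<and> 2 * q > (1 - p) * (1 + s) \<and> r * (1 + s - q) > (1 + s) * (1 + p))"
    by (auto simp: mult.commute)
  then show False
  proof cases
    case 1
    show False by (rule no_positive_solution[OF u v _ _ exponents 1]) (simp_all add: f1_def f2_def)
  next
    case 2
    show False
      by (rule no_positive_solution[OF v u _ _ exponents(2,1,4,3) 2]) (simp_all add: f1_def f2_def mult.commute)
  qed
qed

end
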